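(* Let $K\in\mathcal{U}C_b^3(\mathbb{R}^d,\mathbb{R}^{d\times d})$ and weights $\alpha_j^N\in\mathbb{R}$. For every $N\in\mathbb{N}$ let $\{\gamma_0^{i,N}(\sigma): i=1,\dots,N,\ \sigma\in[0,1]\}$ be a family of $C^1$ curves in $\mathbb{R}^d$, and assume that the currents $$\xi_0^N=\sum_{j=1}^N\alpha_j^N\int_0^1\delta_{\gamma_0^{j,N}(\sigma)}\partial_\sigma\gamma_0^{j,N}(\sigma)\,d\sigma$$ converge weakly (i.e. in the metric $d$) to a current $\xi_0\in\mathcal{M}$. Let $T>0$ be such that on $[0,T]$ there are unique current-valued solutions $\xi^N$ and $\xi$ of $\xi_t=\varphi^{t,K\ast\xi}_\sharp\xi_0$ with initial conditions $\xi_0^N$ and $\xi_0$ respectively; thus $\xi_t^N=\sum_{j=1}^N\alpha_j^N\int_0^1\delta_{\gamma_t^{j,N}(\sigma)}\partial_\sigma\gamma_t^{j,N}(\sigma)\,d\sigma$ where $\gamma_t^{i,N}$ solve $$\partial_t\gamma_t^{i,N}(\sigma)=\sum_{j=1}^N\alpha_j^N\int_0^1K\big(\gamma_t^{i,N}(\sigma)-\gamma_t^{j,N}(\sigma')\big)\partial_{\sigma'}\gamma_t^{j,N}(\sigma')\,d\sigma'$$ with initial curves $\gamma_0^{i,N}$. Let $\overline{\gamma}_t^{i,N}$ be the solution of $\partial_t\overline{\gamma}_t^{i,N}(\sigma)=(K\ast\xi_t)(\overline{\gamma}_t^{i,N}(\sigma))$, $\overline{\gamma}_0^{i,N}=\gamma_0^{i,N}$.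 Then: (i) $\xi^N\to\xi$ in $C([0,T];\mathcal{M}_w)$; (ii) for every fixed $i$, $\lim_{N\to\infty}\sup_{(t,\sigma)\in[0,T]\times[0,1]}|\gamma_t^{i,N}(\sigma)-\overline{\gamma}_t^{i,N}(\sigma)|=0$.
   Context: $\mathcal{U}C_b^3(\mathbb{R}^d,\mathbb{R}^{d\times d})$: $C^3$ matrix-valued functions bounded with derivatives up to order 3, with $K$, $DK$, $D^2K$ uniformly continuous. $\mathcal{M}$ is the dual of $C_b(\mathbb{R}^d;\mathbb{R}^d)$ (bounded continuous vector fields, sup norm $\|\cdot\|_\infty$); weak norm $\|\xi\|=\sup\{\xi(\theta):\|\theta\|_\infty+\mathrm{Lip}(\theta)\le1\}$, metric $d(\xi,\xi')=\|\xi-\xi'\|$; $\mathcal{M}_w$ is $\mathcal{M}$ with this metric. The current $\int_0^1\delta_{\gamma(\sigma)}\partial_\sigma\gamma(\sigma)\,d\sigma$ acts as $\theta\mapsto\int_0^1\langle\theta(\gamma(\sigma)),\partial_\sigma\gamma(\sigma)\rangle d\sigma$. $K\ast\xi$ is the vector field with components $(K\ast\xi)_i(x)=\xi(K_{i\cdot}(x-\cdot))$, $K_{i\cdot}(z)=(K_{ij}(z))_j$. $\varphi^{t,K\ast\xi}$ is the flow of $\frac{dx_t}{dt}=(K\ast\xi_t)(x_t)$, $\varphi^{0,K\ast\xi}=\mathrm{id}$. Push-forward: $(\varphi_\sharp\theta)(x)=D\varphi(x)^T\theta(\varphi(x))$, $(\varphi_\sharp\xi)(\theta)=\xi(\varphi_\sharp\theta)$.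 *)

theory Defs
  imports "HOL-Analysis.Analysis"
begin

type_synonym ('n) current = "((real^'n, real^'n) bcontfun \<Rightarrow>\<^sub>L real)"

definition UCb3 :: "(real^'n::finite \<Rightarrow> real^'n^'n) \<Rightarrow> bool" where
  "UCb3 K \<longleftrightarrow> (\<exists>K1 K2 K3.
      (\<forall>x. (K has_derivative blinfun_apply (K1 x)) (at x)) \<and>
      (\<forall>x. (K1 has_derivative blinfun_apply (K2 x)) (at x)) \<and>
      (\<forall>x. (K2 has_derivative blinfun_apply (K3 x)) (at x)) \<and>
      continuous_on UNIV K3 \<and>
      bounded (range K) \<and> bounded (range K1) \<and> bounded (range K2) \<and> bounded (range K3) \<and>
      uniformly_continuous_on UNIV K \<and> uniformly_continuous_on UNIV K1 \<and>
      uniformly_continuous_on UNIV K2)"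

definition wnorm :: "('n::finite) current \<Rightarrow> real" where
  "wnorm \<xi> = Sup {blinfun_apply \<xi> \<theta> | \<theta>. \<exists>L. L-lipschitz_on UNIV (apply_bcontfun \<theta>) \<and> norm \<theta> + L \<le> 1}"

definition wdist :: "('n::finite) current \<Rightarrow> ('n::finite) current \<Rightarrow> real" where
  "wdist \<xi> \<eta> = wnorm (\<xi> - \<eta>)"

definition curve_current :: "(real \<Rightarrow> real^'n) \<Rightarrow> 'n current" where
  "curve_current g = Blinfun (\<lambda>\<theta>. integral {0..1}
      (\<lambda>\<sigma>. apply_bcontfun \<theta> (g \<sigma>) \<bullet> vector_derivative g (at \<sigma> within {0..1})))"

definition conv :: "(real^'n \<Rightarrow> real^'n^'n) \<Rightarrow> ('n::finite) current \<Rightarrow> real^'n \<Rightarrow> real^'n" where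
  "conv K \<xi> x = (\<chi> i. blinfun_apply \<xi> (Bcontfun (\<lambda>z. K (x - z) $ i)))"

definition push_test :: "(real^'n \<Rightarrow> real^'n) \<Rightarrow> (real^'n, real^'n) bcontfun \<Rightarrow> (real^'n, real^'n) bcontfun" where
  "push_test \<phi> \<theta> = Bcontfun (\<lambda>x. transpose (jacobian \<phi> (at x)) *v apply_bcontfun \<theta> (\<phi> x))"

definition push :: "(real^'n \<Rightarrow> real^'n) \<Rightarrow> ('n::finite) current \<Rightarrow> 'n current" where
  "push \<phi> \<xi> = Blinfun (\<lambda>\<theta>. blinfun_apply \<xi> (push_test \<phi> \<theta>))"

definition is_flow :: "(real \<Rightarrow> real^'n \<Rightarrow> real^'n) \<Rightarrow> real \<Rightarrow> (real \<Rightarrow> real^'n \<Rightarrow> real^'n) \<Rightarrow> bool" where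
  "is_flow v T \<phi> \<longleftrightarrow> (\<forall>x. \<phi> 0 x = x \<and>
      (\<forall>t\<in>{0..T}. ((\<lambda>s. \<phi> s x) has_vector_derivative v t (\<phi> t x)) (at t within {0..T})))"

definition wcont_on :: "real \<Rightarrow> (real \<Rightarrow> ('n::finite) current) \<Rightarrow> bool" where
  "wcont_on T \<xi> \<longleftrightarrow> (\<forall>t\<in>{0..T}. \<forall>e>0. \<exists>d>0. \<forall>s\<in>{0..T}. \<bar>s - t\<bar> < d \<longrightarrow> wdist (\<xi> s) (\<xi> t) < e)"

definition is_solution :: "(real^'n \<Rightarrow> real^'n^'n) \<Rightarrow> ('n::finite) current \<Rightarrow> real \<Rightarrow> (real \<Rightarrow> 'n current) \<Rightarrow> bool" where
  "is_solution K \<xi>0 T \<xi> \<longleftrightarrow> wcont_on T \<xi> \<and> \<xi> 0 = \<xi>0 \<and>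
     (\<exists>\<phi>. is_flow (\<lambda>t x. conv K (\<xi> t) x) T \<phi> \<and> (\<forall>t\<in>{0..T}. \<xi> t = push (\<phi> t) \<xi>0))"

end

theory Submission
  imports Defs
begin

text \<open>
  Everything is measured by first and second differences. Since \<open>K\<close> has three bounded derivatives,
  the sup norm, the Lipschitz constant and the second differences of \<open>K \<ast> \<xi>\<close> are bounded by the weak
  norm of \<open>\<xi>\<close>. Comparing with exponentials, the same holds for the flow it generates, which is therefore
  differentiable with Lipschitz derivative; so push-forward by the flow is continuous for the weak norm,
  and two flows (with their derivatives) differ by the weak distance of the driving currents.
  Suppose the weak distance between \<open>\<xi>\<^sup>N\<^sub>s\<close> and \<open>\<xi>\<^sub>s\<close> is at most \<open>b exp (\<mu> s)\<close> for \<open>s \<le> t\<close>. For \<open>\<mu>\<close> large,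
  the equations \<open>\<xi>\<^sub>t = \<phi>\<^sub>t\<^sub>\<sharp> \<xi>\<^sub>0\<close> then give at time \<open>t\<close> the bound with \<open>b/2\<close> in place of \<open>b\<close>, up to a multiple
  of the initial distance. A first-exit argument turns this into a bound on all of \<open>[0,T]\<close>, and the curves
  are compared in the same way.
\<close>

section \<open>First exit times and comparison with exponentials\<close>

text \<open>At the first time \<open>m\<close> with \<open>g m \<ge> 0\<close>, continuity forces
  \<open>g m \<le> 0\<close>, so \<open>step\<close> applies at \<open>m\<close> and contradicts the
  choice of \<open>m\<close>. The premise of \<open>step\<close> is non-strict and includes the time
  \<open>t\<close> itself; its strict conclusion closes the argument.\<close>

lemma first_exit:
  fixes g :: "real \<Rightarrow> real"
  assumes cont: "continuous_on {0..\<tau>} g" and init: "g 0 < 0"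
    and step: "\<And>t. t \<in> {0..\<tau>} \<Longrightarrow> (\<And>s. s \<in> {0..t} \<Longrightarrow> g s \<le> 0) \<Longrightarrow> g t < 0"
    and t: "t \<in> {0..\<tau>}"
  shows "g t < 0"
proof (rule ccontr)
  assume neg: "\<not> g t < 0"
  define A where "A = {s \<in> {0..\<tau>}. g s \<in> {0..}}"
  have "closed A"
    unfolding A_def using cont by (intro continuous_closed_preimage[unfolded vimage_def Int_def, simplified] ) auto
  moreover have tA: "t \<in> A" using neg t by (auto simp: A_def)
  moreover have bb: "bdd_below A" by (rule bdd_belowI[of _ 0]) (auto simp: A_def)
  ultimately have m: "Inf A \<in> A"
    using closed_contains_Inf by blast
  define m where "m = Inf A"
  have mA: "m \<in> {0..\<tau>}" "g m \<ge> 0" using m by (auto simp: A_def m_def)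
  have low: "g s < 0" if "s \<in> {0..<m}" for s
  proof (rule ccontr)
    assume "\<not> g s < 0"
    then have "s \<in> A" using that mA by (auto simp: A_def)
    then show False using cInf_lower[OF _ bb] that by (fastforce simp: m_def)
  qed
  have "g m \<le> 0"
  proof (rule ccontr)
    assume "\<not> g m \<le> 0"
    moreover have "continuous_on {0..m} g" using cont mA by (auto elim: continuous_on_subset)
    ultimately obtain s where "0 \<le> s" "s \<le> m" "g s = 0"
      using IVT'[of g 0 0 m] init mA by auto
    then show False using low[of s] \<open>\<not> g m \<le> 0\<close> by (cases "s = m") auto
  qed
  then have "g m < 0"
    using low mA(1) by (intro step) (metis atLeastAtMost_iff atLeastLessThan_iff order_le_less)+
  with mA show False by simp
qed

text \<open>Gronwall with a source term: \<open>A + L * c \<le> \<mu> * c\<close> makes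
  \<open>c * exp (\<mu> * t)\<close> a supersolution. The exit argument needs a strict start, so
  \<open>c\<close> is replaced by \<open>c + \<delta>\<close>, which \<open>L \<le> \<mu>\<close>
  permits, and then \<delta> tends to 0. For zero initial value and \<open>L < \<mu>\<close> one may
  take \<open>c = A / (\<mu> - L)\<close>: a fast weight makes the constant small.\<close>

lemma exp_comparison:
  fixes u :: "real \<Rightarrow> 'a::real_normed_vector"
  assumes deriv: "\<And>t. t \<in> {0..\<tau>} \<Longrightarrow> (u has_vector_derivative u' t) (at t within {0..\<tau>})"
    and bound: "\<And>t. t \<in> {0..\<tau>} \<Longrightarrow> norm (u' t) \<le> A * exp (\<mu> * t) + L * norm (u t)"
    and init: "norm (u 0) \<le> c" and const: "A + L * c \<le> \<mu> * c" "0 \<le> L" "L \<le> \<mu>"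
    and t: "t \<in> {0..\<tau>}"
  shows "norm (u t) \<le> c * exp (\<mu> * t)"
proof -
  have contu: "continuous_on {0..\<tau>} u"
    using deriv by (rule continuous_on_vector_derivative)
  have "norm (u t) - (c + \<delta>) * exp (\<mu> * t) < 0" if \<delta>: "\<delta> > 0" for \<delta>
  proof (rule first_exit[OF _ _ _ t])
    show "continuous_on {0..\<tau>} (\<lambda>t. norm (u t) - (c + \<delta>) * exp (\<mu> * t))"
      by (intro continuous_intros contu)
    show "norm (u 0) - (c + \<delta>) * exp (\<mu> * 0) < 0" using init \<delta> by simp
    fix r assume r: "r \<in> {0..\<tau>}"
      and le: "\<And>s. s \<in> {0..r} \<Longrightarrow> norm (u s) - (c + \<delta>) * exp (\<mu> * s) \<le> 0"
    show "norm (u r) - (c + \<delta>) * exp (\<mu> * r) < 0"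
    proof (cases "r = 0")
      case True then show ?thesis using init \<delta> by simp
    next
      case False
      have "norm (u r - u 0) \<le> (c + \<delta>) * exp (\<mu> * r) - (c + \<delta>) * exp (\<mu> * 0)"
      proof (rule differentiable_bound_general)
        show "0 < r" using r False by simp
        show "continuous_on {0..r} u" using contu r by (auto elim: continuous_on_subset)
        show "continuous_on {0..r} (\<lambda>r. (c + \<delta>) * exp (\<mu> * r))" by (intro continuous_intros)
        fix x assume x: "0 < x" "x < r"
        have "(u has_vector_derivative u' x) (at x within {0<..<\<tau>})"
          using deriv[of x] x r by (auto intro: has_vector_derivative_within_subset)
        then show "(u has_vector_derivative u' x) (at x)"
          using x r by (subst (asm) at_within_open) auto
        show "((\<lambda>r. (c + \<delta>) * exp (\<mu> * r)) has_vector_derivative ((c + \<delta>) * exp (\<mu> * x) * \<mu>)) (at x)"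
          by (auto intro!: derivative_eq_intros simp: has_real_derivative_iff_has_vector_derivative[symmetric])
        have "norm (u' x) \<le> A * exp (\<mu> * x) + L * norm (u x)" using bound[of x] x r by auto
        also have "\<dots> \<le> A * exp (\<mu> * x) + L * ((c + \<delta>) * exp (\<mu> * x))"
          using le[of x] x r const(2) by (auto intro!: mult_left_mono)
        also have "\<dots> = ((A + L * c) + L * \<delta>) * exp (\<mu> * x)" by (simp add: algebra_simps)
        also have "\<dots> \<le> (\<mu> * c + \<mu> * \<delta>) * exp (\<mu> * x)"
          using const \<delta> by (intro mult_right_mono add_mono) auto
        finally show "norm (u' x) \<le> (c + \<delta>) * exp (\<mu> * x) * \<mu>" by (simp add: algebra_simps)
      qed
      then show ?thesis using norm_triangle_sub[of "u r" "u 0"] init \<delta> by simp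
    qed
  qed
  then have "norm (u t) - c * exp (\<mu> * t) < \<delta> * exp (\<mu> * t)" if "\<delta> > 0" for \<delta>
    using that by (simp add: algebra_simps)
  from this[of "e / exp (\<mu> * t)" for e] have "norm (u t) - c * exp (\<mu> * t) < e" if "e > 0" for e
    using that by simp
  then have "norm (u t) - c * exp (\<mu> * t) \<le> 0"
    by (meson less_irrefl not_le)
  then show ?thesis by simp
qed

section \<open>Functions with bounded first and second differences\<close>

definition second_diff :: "('a::real_vector \<Rightarrow> 'b::real_vector) \<Rightarrow> 'a \<Rightarrow> 'a \<Rightarrow> 'a \<Rightarrow> 'b" where
  "second_diff f x a b = f (x + a + b) - f (x + a) - f (x + b) + f x"

text \<open>For Banach-valued maps this amounts to differentiability, with \<open>L\<close> bounding
  the derivative and \<open>H\<close> its Lipschitz constant. In terms of differences it can be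
  proved for a flow by comparing trajectories, before the flow is known to be
  differentiable.\<close>

definition C11_bound ::
  "real \<Rightarrow> real \<Rightarrow> ('a::real_normed_vector \<Rightarrow> 'b::real_normed_vector) \<Rightarrow> bool" where
  "C11_bound L H f \<longleftrightarrow> (\<forall>x a. norm (f (x + a) - f x) \<le> L * norm a) \<and>
     (\<forall>x a b. norm (second_diff f x a b) \<le> H * norm a * norm b)"

lemma C11_boundD:
  assumes "C11_bound L H f"
  shows "norm (f y - f x) \<le> L * norm (y - x)"
    and "norm (second_diff f x a b) \<le> H * norm a * norm b"
proof -
  have "norm (f (x + (y - x)) - f x) \<le> L * norm (y - x)"
    using assms unfolding C11_bound_def by blast
  then show "norm (f y - f x) \<le> L * norm (y - x)" by simp
  show "norm (second_diff f x a b) \<le> H * norm a * norm b"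
    using assms unfolding C11_bound_def by blast
qed

text \<open>The defect \<open>r\<close> of homogeneity along a line is additive and vanishes at
  integers, so it has period 1 and is bounded by its values on the unit interval. As
  \<open>r (n * c)\<close> is \<open>n\<close> times \<open>r c\<close>, boundedness forces
  \<open>r\<close> to be zero.\<close>

lemma additive_bounded_imp_linear:
  fixes D :: "'a::real_normed_vector \<Rightarrow> 'b::real_normed_vector"
  assumes add: "\<And>a b. D (a + b) = D a + D b" and bd: "\<And>a. norm (D a) \<le> L * norm a"
  shows "bounded_linear D"
proof (rule bounded_linear_intro[of D L])
  fix c :: real and a
  define r where "r c = D (c *\<^sub>R a) - c *\<^sub>R D a" for c :: real
  have radd: "r (c + d) = r c + r d" for c d
    by (simp add: r_def add scaleR_add_left algebra_simps)
  have r1: "r 1 = 0" by (simp add: r_def)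
  have r0: "r 0 = 0" using radd[of 0 0] by simp
  have rn: "r (real n * c) = real n *\<^sub>R r c" for n c
    by (induction n) (simp_all add: r0 radd distrib_right scaleR_add_left)
  have rneg: "r (- c) = - r c" for c using radd[of c "-c"] r0 by (simp add: eq_neg_iff_add_eq_0 add.commute)
  have rint: "r (of_int k) = 0" for k
    using rn[of "nat k" 1] rn[of "nat (-k)" 1] rneg[of "of_int (-k)"] r1
    by (cases "k \<ge> 0") auto
  define B where "B = \<bar>L\<bar> * norm a + norm (D a)"
  have rB: "norm (r c) \<le> B" for c
  proof -
    have "r c = r (frac c)"
      using radd[of "frac c" "of_int \<lfloor>c\<rfloor>"] rint by (simp add: frac_def)
    also have "norm \<dots> \<le> norm (D (frac c *\<^sub>R a)) + norm (frac c *\<^sub>R D a)"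
      unfolding r_def by (rule norm_triangle_ineq4)
    also have "\<dots> \<le> L * (frac c * norm a) + frac c * norm (D a)"
      using bd[of "frac c *\<^sub>R a"] frac_ge_0[of c] by simp
    also have "\<dots> \<le> \<bar>L\<bar> * (1 * norm a) + 1 * norm (D a)"
      using frac_lt_1[of c] frac_ge_0[of c]
      by (intro add_mono mult_mono) (auto intro: less_imp_le)
    finally show ?thesis by (simp add: B_def)
  qed
  have "norm (r c) = 0"
  proof (rule ccontr)
    assume "norm (r c) \<noteq> 0"
    then obtain n :: nat where "B < real n * norm (r c)"
      using reals_Archimedean3[of "norm (r c)"] by auto
    with rB[of "real n * c"] show False by (simp add: rn)
  qed
  then show "D (c *\<^sub>R a) = c *\<^sub>R D a" by (simp add: r_def)
qed (use add bd in \<open>auto simp: mult.commute\<close>)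

text \<open>The derivative is the limit of the dyadic difference quotients at \<open>x\<close>: the second-difference
  bound makes them Cauchy and the limit additive.\<close>

lemma C11_bound_differentiable:
  fixes f :: "'a::real_normed_vector \<Rightarrow> 'b::banach"
  assumes f: "C11_bound L H f"
  shows "f differentiable (at x)"
proof -
  define q where "q k a = (2::real)^k *\<^sub>R (f (x + (1/2)^k *\<^sub>R a) - f x)" for k a
  have pw: "(2::real)^k * (1/2)^k = 1" for k :: nat by (simp add: power_one_over)
  \<comment> \<open>Going from step \<open>b + b\<close> to step \<open>b\<close> changes the
    quotient by a second difference with both increments equal to \<open>b\<close>; it is of order
    \<open>4^-k\<close>, against the factor \<open>2^k\<close>.\<close>
  have diff: "norm (q (Suc k) a - q k a) \<le> (H * (norm a)\<^sup>2 / 4) * (1/2)^k" for k a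
  proof -
    define b where "b = (1/2)^Suc k *\<^sub>R a"
    have bb: "(1/2)^k *\<^sub>R a = b + b" unfolding b_def by (simp flip: scaleR_add_left)
    have "q (Suc k) a - q k a = - ((2::real)^k *\<^sub>R second_diff f x b b)"
      unfolding q_def bb second_diff_def b_def[symmetric]
      by (simp add: algebra_simps scaleR_2 flip: scaleR_scaleR)
    then have "norm (q (Suc k) a - q k a) = 2^k * norm (second_diff f x b b)" by simp
    also have "\<dots> \<le> 2^k * (H * norm b * norm b)"
      using C11_boundD(2)[OF f] by (intro mult_left_mono) auto
    also have "\<dots> = (2^k * (1/2)^k) * (H * (norm a)\<^sup>2 / 4) * (1/2)^k"
      unfolding b_def by (simp add: power2_eq_square algebra_simps)
    finally show ?thesis unfolding pw by simp
  qed
  have sm: "summable (\<lambda>k. (H * (norm a)\<^sup>2 / 4) * (1/2)^k)" for a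
    by (intro summable_mult summable_geometric) simp
  have smq: "summable (\<lambda>k. q (Suc k) a - q k a)" for a
    using diff by (intro summable_comparison_test[OF _ sm[of a]]) auto
  define D where "D a = q 0 a + (\<Sum>k. q (Suc k) a - q k a)" for a
  have lim: "(\<lambda>k. q k a) \<longlonglongrightarrow> D a" for a
    using tendsto_add[OF tendsto_const[of "q 0 a"] summable_LIMSEQ[OF smq[of a]]]
    unfolding D_def sum_lessThan_telescope[of "\<lambda>k. q k a"] by simp
  \<comment> \<open>\<open>q 0 a\<close> is the full increment of \<open>f\<close>, so the remainder
    is the whole telescoping series, and its bound is quadratic in \<open>a\<close>.\<close>
  have rem: "norm (f (x + a) - f x - D a) \<le> H / 2 * (norm a)\<^sup>2" for a
  proof -
    have "norm (f (x + a) - f x - D a) = norm (\<Sum>k. q (Suc k) a - q k a)"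
      unfolding D_def by (simp add: q_def)
    also have "\<dots> \<le> (\<Sum>k. (H * (norm a)\<^sup>2 / 4) * (1/2)^k)"
      by (rule norm_suminf_le[OF diff sm])
    also have "\<dots> = H / 2 * (norm a)\<^sup>2"
      by (subst suminf_mult) (auto simp: suminf_geometric)
    finally show ?thesis .
  qed
  have Dadd: "D (a + b) = D a + D b" for a b
  proof -
    have "(\<lambda>k. q k (a + b) - (q k a + q k b)) \<longlonglongrightarrow> 0"
    proof (rule Lim_null_comparison)
      show "\<forall>\<^sub>F k in sequentially. norm (q k (a + b) - (q k a + q k b)) \<le> (H * norm a * norm b) * (1/2)^k"
      proof (intro always_eventually allI)
        fix k
        have "q k (a + b) - (q k a + q k b) = 2^k *\<^sub>R second_diff f x ((1/2)^k *\<^sub>R a) ((1/2)^k *\<^sub>R b)"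
          unfolding q_def second_diff_def by (simp add: algebra_simps)
        then have "norm (q k (a + b) - (q k a + q k b))
            \<le> 2^k * (H * norm ((1/2)^k *\<^sub>R a) * norm ((1/2)^k *\<^sub>R b))"
          using C11_boundD(2)[OF f, of x "(1/2)^k *\<^sub>R a" "(1/2)^k *\<^sub>R b"]
          by (auto simp: mult.assoc)
        also have "\<dots> = (2^k * (1/2)^k) * (H * norm a * norm b) * (1/2)^k" by simp
        finally show "norm (q k (a + b) - (q k a + q k b)) \<le> (H * norm a * norm b) * (1/2)^k"
          unfolding pw by simp
      qed
      show "(\<lambda>k. (H * norm a * norm b) * (1/2)^k) \<longlonglongrightarrow> 0"
        by (intro tendsto_mult_right_zero LIMSEQ_power_zero) simp
    qed
    moreover have "(\<lambda>k. q k (a + b) - (q k a + q k b)) \<longlonglongrightarrow> D (a + b) - (D a + D b)"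
      by (intro tendsto_intros lim)
    ultimately show ?thesis using LIMSEQ_unique by fastforce
  qed
  have Dbd: "norm (D a) \<le> L * norm a" for a
  proof (rule Lim_norm_ubound[OF _ lim[of a]])
    show "\<forall>\<^sub>F k in sequentially. norm (q k a) \<le> L * norm a"
    proof (intro always_eventually allI)
      fix k
      have "norm (q k a) \<le> 2^k * (L * norm ((1/2)^k *\<^sub>R a))"
        unfolding q_def using C11_boundD(1)[OF f, of "x + (1/2)^k *\<^sub>R a" x]
        by (auto intro!: mult_left_mono)
      also have "\<dots> = (2^k * (1/2)^k) * (L * norm a)" by simp
      finally show "norm (q k a) \<le> L * norm a" unfolding pw by simp
    qed
  qed simp
  have "(f has_derivative D) (at x)"
    unfolding has_derivative_at
  proof
    show "bounded_linear D" using Dadd Dbd by (rule additive_bounded_imp_linear)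
    show "(\<lambda>h. norm (f (x + h) - f x - D h) / norm h) \<midarrow>0\<rightarrow> 0"
    proof (rule Lim_null_comparison)
      show "\<forall>\<^sub>F h in at 0. norm (norm (f (x + h) - f x - D h) / norm h) \<le> H / 2 * norm h"
        using rem by (intro eventually_at_filter[THEN iffD2] always_eventually)
           (auto simp: divide_le_eq power2_eq_square mult.assoc)
      show "(\<lambda>h::'a. H / 2 * norm h) \<midarrow>0\<rightarrow> 0"
        by (intro tendsto_mult_right_zero tendsto_norm_zero tendsto_ident_at)
    qed
  qed
  then show ?thesis by (auto simp: differentiable_def)
qed

text \<open>Divide the increments along \<open>t *\<^sub>R a\<close> by \<open>t\<close> and let
  \<open>t\<close> tend to 0. This carries bounds on differences over to derivatives; it is applied
  to \<open>f\<close>, to a translate of \<open>f\<close> minus \<open>f\<close>, and to the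
  difference of two maps.\<close>

lemma has_derivative_norm_le:
  fixes h :: "'a::real_normed_vector \<Rightarrow> 'b::real_normed_vector"
  assumes h: "(h has_derivative h') (at x)" and le: "\<And>a. norm (h (x + a) - h x) \<le> c * norm a"
  shows "norm (h' a) \<le> c * norm a"
proof (cases "a = 0")
  case True then show ?thesis using has_derivative_linear[OF h] by (simp add: linear_0)
next
  case False
  have "((\<lambda>t. h (x + t *\<^sub>R a)) has_vector_derivative h' a) (at 0)"
  proof -
    have "((\<lambda>t::real. x + t *\<^sub>R a) has_derivative (\<lambda>t. t *\<^sub>R a)) (at 0)"
      by (auto intro!: derivative_eq_intros)
    from diff_chain_at[OF this, of h h'] h show ?thesis
      using has_derivative_linear[OF h]
      by (simp add: o_def has_vector_derivative_def linear_cmul)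
  qed
  then have "((\<lambda>t. (h (x + t *\<^sub>R a) - h x) /\<^sub>R t) \<longlongrightarrow> h' a) (at 0)"
  proof -
    assume "((\<lambda>t. h (x + t *\<^sub>R a)) has_vector_derivative h' a) (at 0)"
    then have "(\<lambda>t. norm (h (x + t *\<^sub>R a) - h x - t *\<^sub>R h' a) / norm t) \<midarrow>0\<rightarrow> 0"
      by (simp add: has_vector_derivative_def has_derivative_at)
    then have "(\<lambda>t. norm ((h (x + t *\<^sub>R a) - h x) /\<^sub>R t - h' a)) \<midarrow>0\<rightarrow> 0"
    proof (rule Lim_transform_eventually, intro eventually_at_filter[THEN iffD2] always_eventually allI impI)
      fix t :: real assume "t \<noteq> 0"
      then have "(h (x + t *\<^sub>R a) - h x) /\<^sub>R t - h' a = (h (x + t *\<^sub>R a) - h x - t *\<^sub>R h' a) /\<^sub>R t"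
        by (simp add: scaleR_diff_right)
      then show "norm (h (x + t *\<^sub>R a) - h x - t *\<^sub>R h' a) / norm t
          = norm ((h (x + t *\<^sub>R a) - h x) /\<^sub>R t - h' a)"
        by (simp add: divide_inverse mult.commute)
    qed
    from tendsto_norm_zero_cancel[OF this] show ?thesis by (rule LIM_zero_cancel)
  qed
  then show ?thesis
  proof (rule Lim_norm_ubound[rotated])
    show "\<forall>\<^sub>F t in at 0. norm ((h (x + t *\<^sub>R a) - h x) /\<^sub>R t) \<le> c * norm a"
    proof (rule eventually_at_filter[THEN iffD2], intro always_eventually allI impI)
      fix t :: real assume "t \<noteq> 0"
      with le[of "t *\<^sub>R a"] show "norm ((h (x + t *\<^sub>R a) - h x) /\<^sub>R t) \<le> c * norm a"
        by (simp add: inverse_eq_divide divide_le_eq mult_ac)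
    qed
  qed simp
qed

section \<open>The weak norm and the weak distance\<close>

text \<open>A real supremum is an upper bound only for a set that is bounded above. Admissible test
  functions have norm at most 1, because Lipschitz constants are nonnegative, so the operator norm
  of \<xi> is a bound.\<close>

lemma blinfun_apply_le_wnorm:
  assumes "l-lipschitz_on UNIV (apply_bcontfun \<theta>)" "norm \<theta> + l \<le> 1"
  shows "blinfun_apply \<xi> \<theta> \<le> wnorm \<xi>"
  unfolding wnorm_def
proof (rule cSup_upper)
  show "bdd_above {blinfun_apply \<xi> \<theta> |\<theta>. \<exists>L. L-lipschitz_on UNIV (apply_bcontfun \<theta>) \<and> norm \<theta> + L \<le> 1}"
  proof (rule bdd_aboveI[of _ "norm \<xi>"], clarify)
    fix \<theta> :: "(real^'a) \<Rightarrow>\<^sub>C (real^'a)" and L assume "L-lipschitz_on UNIV (apply_bcontfun \<theta>)" "norm \<theta> + L \<le> 1"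
    then have "norm \<theta> \<le> 1" using lipschitz_on_nonneg by fastforce
    then show "blinfun_apply \<xi> \<theta> \<le> norm \<xi>"
      using norm_blinfun[of \<xi> \<theta>] mult_left_le[of "norm \<theta>" "norm \<xi>"] by auto
  qed
qed (use assms in blast)

lemma wnorm_le:
  assumes "\<And>\<theta> l. l-lipschitz_on UNIV (apply_bcontfun \<theta>) \<Longrightarrow> norm \<theta> + l \<le> 1 \<Longrightarrow> blinfun_apply \<xi> \<theta> \<le> c"
  shows "wnorm \<xi> \<le> c"
  unfolding wnorm_def
proof (rule cSup_least)
  have "0-lipschitz_on UNIV (apply_bcontfun (0::(real^'a) \<Rightarrow>\<^sub>C (real^'a)))"
    by (rule lipschitz_onI) auto
  then show "{blinfun_apply \<xi> \<theta> |\<theta>. \<exists>L. L-lipschitz_on UNIV (apply_bcontfun \<theta>) \<and> norm \<theta> + L \<le> 1} \<noteq> {}"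
    by fastforce
qed (use assms in blast)

lemma wnorm_nonneg: "0 \<le> wnorm \<xi>"
proof -
  have "0-lipschitz_on UNIV (apply_bcontfun (0::(real^'a) \<Rightarrow>\<^sub>C (real^'a)))"
    by (rule lipschitz_onI) auto
  from blinfun_apply_le_wnorm[OF this, of \<xi>] show ?thesis by (simp add: blinfun.zero_right)
qed

lemma lipschitz_on_scaleR_bcontfun:
  assumes "l-lipschitz_on UNIV (apply_bcontfun \<theta>)"
  shows "(\<bar>c\<bar> * l)-lipschitz_on UNIV (apply_bcontfun (c *\<^sub>R \<theta>))"
  using lipschitz_on_cmult[OF assms, of c] by simp

text \<open>Dividing \<open>\<theta>\<close> by \<open>S + l\<close>, with either sign, makes it
  admissible for the weak norm. Any upper bound \<open>S\<close> is allowed because the norm of a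
  pushed-forward test function is only estimated.\<close>

lemma abs_blinfun_apply_le_wnorm:
  assumes l: "l-lipschitz_on UNIV (apply_bcontfun \<theta>)" and S: "norm \<theta> \<le> S"
  shows "\<bar>blinfun_apply \<xi> \<theta>\<bar> \<le> wnorm \<xi> * (S + l)"
proof (cases "S + l = 0")
  case True
  then have "\<theta> = 0" using lipschitz_on_nonneg[OF l] S by (metis add_nonneg_eq_0_iff norm_ge_zero norm_le_zero_iff order_trans)
  then show ?thesis using True by (simp add: blinfun.zero_right)
next
  case False
  define s where "s = S + l"
  have s: "s > 0" "norm \<theta> + l \<le> s"
    using False lipschitz_on_nonneg[OF l] S norm_ge_zero[of \<theta>] unfolding s_def by linarith+
  have "blinfun_apply \<xi> (c *\<^sub>R \<theta>) \<le> wnorm \<xi>" if "\<bar>c\<bar> = 1 / s" for c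
  proof (rule blinfun_apply_le_wnorm[OF lipschitz_on_scaleR_bcontfun[OF l]])
    have "norm (c *\<^sub>R \<theta>) + \<bar>c\<bar> * l = (norm \<theta> + l) / s" using that by (simp add: add_divide_distrib)
    then show "norm (c *\<^sub>R \<theta>) + \<bar>c\<bar> * l \<le> 1" using s by simp
  qed
  from this[of "1/s"] this[of "-(1/s)"] s
  have "\<bar>blinfun_apply \<xi> \<theta>\<bar> / s \<le> wnorm \<xi>"
    by (auto simp: blinfun.scaleR_right blinfun.minus_right abs_if)
  then show ?thesis using s by (simp add: s_def[symmetric] divide_le_eq)
qed

lemma wnorm_zero [simp]: "wnorm 0 = 0"
  by (intro antisym wnorm_nonneg wnorm_le) simp

lemma wnorm_triangle: "wnorm (\<xi> + \<eta>) \<le> wnorm \<xi> + wnorm \<eta>"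
  by (rule wnorm_le) (auto simp: blinfun.add_left intro!: add_mono blinfun_apply_le_wnorm)

lemma wnorm_minus: "wnorm (- \<xi>) = wnorm \<xi>"
proof -
  have le: "wnorm (- \<eta>) \<le> wnorm \<eta>" for \<eta> :: "'a current"
  proof (rule wnorm_le)
    fix \<theta> :: "(real^'a) \<Rightarrow>\<^sub>C (real^'a)" and l
    assume "l-lipschitz_on UNIV (apply_bcontfun \<theta>)" "norm \<theta> + l \<le> 1"
    then have "blinfun_apply \<eta> ((-1) *\<^sub>R \<theta>) \<le> wnorm \<eta>"
      by (intro blinfun_apply_le_wnorm[OF lipschitz_on_scaleR_bcontfun]) auto
    then show "blinfun_apply (- \<eta>) \<theta> \<le> wnorm \<eta>"
      by (simp add: blinfun.minus_left blinfun.minus_right)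
  qed
  from le[of \<xi>] le[of "- \<xi>"] show ?thesis by simp
qed

lemma wdist_commute: "wdist \<xi> \<eta> = wdist \<eta> \<xi>"
  unfolding wdist_def using wnorm_minus[of "\<xi> - \<eta>"] by simp

lemma wdist_triangle: "wdist \<xi> \<zeta> \<le> wdist \<xi> \<eta> + wdist \<eta> \<zeta>"
  unfolding wdist_def using wnorm_triangle[of "\<xi> - \<eta>" "\<eta> - \<zeta>"] by simp

lemma continuous_on_wdist:
  assumes "wcont_on T \<xi>" "wcont_on T \<eta>"
  shows "continuous_on {0..T} (\<lambda>t. wdist (\<xi> t) (\<eta> t))"
  unfolding continuous_on_iff
proof (intro ballI allI impI)
  fix t e :: real assume t: "t \<in> {0..T}" and e: "e > 0"
  obtain d1 where d1: "d1 > 0" "\<And>s. s \<in> {0..T} \<Longrightarrow> \<bar>s - t\<bar> < d1 \<Longrightarrow> wdist (\<xi> s) (\<xi> t) < e / 2"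
    using assms(1) t e unfolding wcont_on_def by (meson half_gt_zero)
  obtain d2 where d2: "d2 > 0" "\<And>s. s \<in> {0..T} \<Longrightarrow> \<bar>s - t\<bar> < d2 \<Longrightarrow> wdist (\<eta> s) (\<eta> t) < e / 2"
    using assms(2) t e unfolding wcont_on_def by (meson half_gt_zero)
  have "dist (wdist (\<xi> s) (\<eta> s)) (wdist (\<xi> t) (\<eta> t)) < e"
    if s: "s \<in> {0..T}" "dist s t < min d1 d2" for s
  proof -
    have "wdist (\<xi> s) (\<eta> s) \<le> wdist (\<xi> s) (\<xi> t) + (wdist (\<xi> t) (\<eta> t) + wdist (\<eta> t) (\<eta> s))"
      using wdist_triangle[of "\<xi> s" "\<eta> s" "\<xi> t"] wdist_triangle[of "\<xi> t" "\<eta> s" "\<eta> t"] by linarith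
    moreover have "wdist (\<xi> t) (\<eta> t) \<le> wdist (\<xi> t) (\<xi> s) + (wdist (\<xi> s) (\<eta> s) + wdist (\<eta> s) (\<eta> t))"
      using wdist_triangle[of "\<xi> t" "\<eta> t" "\<xi> s"] wdist_triangle[of "\<xi> s" "\<eta> t" "\<eta> s"] by linarith
    moreover have "wdist (\<xi> s) (\<xi> t) < e / 2" "wdist (\<eta> s) (\<eta> t) < e / 2"
      using s d1 d2 by (auto simp: dist_real_def)
    ultimately show ?thesis
      unfolding dist_real_def using wdist_commute[of "\<xi> s" "\<xi> t"] wdist_commute[of "\<eta> s" "\<eta> t"] by linarith
  qed
  then show "\<exists>d>0. \<forall>s\<in>{0..T}. dist s t < d \<longrightarrow> dist (wdist (\<xi> s) (\<eta> s)) (wdist (\<xi> t) (\<eta> t)) < e"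
    using d1 d2 by (intro exI[of _ "min d1 d2"]) auto
qed

lemma wcont_on_wnorm_bounded:
  assumes "wcont_on T \<xi>"
  obtains M where "0 \<le> M" "\<And>t. t \<in> {0..T} \<Longrightarrow> wnorm (\<xi> t) \<le> M"
proof -
  \<comment> \<open>The weak norm is the weak distance to the zero current, so
    \<open>continuous_on_wdist\<close> covers it.\<close>
  have "wcont_on T (\<lambda>_. 0 :: 'a current)" unfolding wcont_on_def wdist_def by (auto intro: exI[of _ 1])
  from continuous_on_wdist[OF assms this] have "continuous_on {0..T} (\<lambda>t. wnorm (\<xi> t))"
    by (simp add: wdist_def)
  then have "compact ((\<lambda>t. wnorm (\<xi> t)) ` {0..T})" by (intro compact_continuous_image) auto
  then obtain b where "\<forall>y\<in>(\<lambda>t. wnorm (\<xi> t)) ` {0..T}. norm y \<le> b"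
    using compact_imp_bounded bounded_iff by blast
  then show thesis by (intro that[of "max b 0"]) force+
qed

section \<open>Convolution of the kernel with a current\<close>

lemma row_bcontfun:
  fixes h :: "real^'n \<Rightarrow> real^'n^'n"
  assumes "h \<in> bcontfun"
  shows "(\<lambda>z. h (x - z) $ i) \<in> bcontfun"
proof -
  from assms have c: "continuous_on UNIV h" and "bounded (range h)" by (auto simp: bcontfun_def)
  then obtain b where "\<And>z. norm (h z) \<le> b" by (auto simp: bounded_iff)
  then have "norm (h (x - z) $ i) \<le> b" for z
    by (rule order_trans[OF Finite_Cartesian_Product.norm_nth_le])
  moreover have "continuous_on UNIV (\<lambda>z. h (x - z) $ i)"
    by (intro continuous_intros continuous_on_compose2[OF c]) auto
  ultimately show ?thesis by (intro bcontfun_normI)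
qed

lemma conv_minus_kernel:
  fixes g h :: "real^'n \<Rightarrow> real^'n^'n"
  assumes "g \<in> bcontfun" "h \<in> bcontfun"
  shows "conv (\<lambda>z. g z - h z) \<xi> x = conv g \<xi> x - conv h \<xi> x"
proof -
  have "Bcontfun (\<lambda>z. (g (x - z) - h (x - z)) $ i)
      = Bcontfun (\<lambda>z. g (x - z) $ i) - Bcontfun (\<lambda>z. h (x - z) $ i)" for i
    using row_bcontfun[OF assms(1)] row_bcontfun[OF assms(2)] row_bcontfun[OF minus_cont[OF assms]]
    by (intro bcontfun_eqI) (simp add: Bcontfun_inverse)
  then show ?thesis by (simp add: conv_def vec_eq_iff blinfun.diff_right)
qed

lemma conv_minus_current: "conv K (\<xi> - \<eta>) x = conv K \<xi> x - conv K \<eta> x"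
  by (simp add: conv_def vec_eq_iff blinfun.diff_left)

text \<open>Moving an increment from the argument into the kernel, together with
  \<open>conv_minus_kernel\<close>, turns differences of \<open>conv h \<xi>\<close> into
  convolutions with differences of \<open>h\<close>.\<close>

lemma conv_shift: "conv h \<xi> (x + a) = conv (\<lambda>z. h (z + a)) \<xi> x"
  by (simp add: conv_def algebra_simps)

lemma shift_bcontfun:
  fixes h :: "real^'n \<Rightarrow> 'b::metric_space"
  assumes "h \<in> bcontfun"
  shows "(\<lambda>z. h (z + a)) \<in> bcontfun"
proof -
  have "range (\<lambda>z. h (z + a)) \<subseteq> range h" by auto
  then show ?thesis using assms
    by (auto simp: bcontfun_def intro: bounded_subset intro!: continuous_on_compose2[of UNIV h] continuous_intros)
qed

text \<open>Each row of \<open>h (x - z)\<close> is a test function with norm and Lipschitz constant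
  at most \<open>c\<close>, which gives \<open>2 * c\<close> per component; summing over components
  gives the dimension. It is applied to \<open>K\<close> and to its first and second
  differences.\<close>

lemma norm_conv_le:
  fixes h :: "real^'n \<Rightarrow> real^'n^'n"
  assumes bd: "\<And>z. norm (h z) \<le> c" and lip: "\<And>z y. norm (h z - h y) \<le> c * norm (z - y)"
  shows "norm (conv h \<xi> x) \<le> real CARD('n) * 2 * c * wnorm \<xi>"
proof -
  have c: "0 \<le> c" using bd[of 0] norm_ge_zero order_trans by blast
  have "c-lipschitz_on UNIV h" using lip c by (auto intro!: lipschitz_onI simp: dist_norm)
  then have h: "h \<in> bcontfun"
    using bd lipschitz_on_continuous_on by (auto intro!: bcontfun_normI)
  have "\<bar>conv h \<xi> x $ i\<bar> \<le> wnorm \<xi> * (c + c)" for i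
  proof -
    let ?\<theta> = "Bcontfun (\<lambda>z. h (x - z) $ i)"
    have app: "apply_bcontfun ?\<theta> = (\<lambda>z. h (x - z) $ i)"
      using row_bcontfun[OF h] by (rule Bcontfun_inverse)
    have "c-lipschitz_on UNIV (apply_bcontfun ?\<theta>)"
    proof (rule lipschitz_onI)
      fix z y
      have "norm ((h (x - z) - h (x - y)) $ i) \<le> c * norm ((x - z) - (x - y))"
        by (rule order_trans[OF Finite_Cartesian_Product.norm_nth_le lip])
      then show "dist (apply_bcontfun ?\<theta> z) (apply_bcontfun ?\<theta> y) \<le> c * dist z y"
        unfolding app dist_norm by (simp add: norm_minus_commute)
    qed (use c in auto)
    moreover have "norm ?\<theta> \<le> c"
      by (rule norm_bound) (unfold app, rule order_trans[OF Finite_Cartesian_Product.norm_nth_le bd])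
    ultimately have "\<bar>blinfun_apply \<xi> ?\<theta>\<bar> \<le> wnorm \<xi> * (c + c)"
      by (rule abs_blinfun_apply_le_wnorm)
    then show ?thesis by (simp only: conv_def vec_lambda_beta)
  qed
  then have "(\<Sum>i\<in>UNIV. \<bar>conv h \<xi> x $ i\<bar>) \<le> (\<Sum>i\<in>(UNIV::'n set). wnorm \<xi> * (c + c))"
    by (intro sum_mono) auto
  then show ?thesis using norm_le_l1_cart[of "conv h \<xi> x"] by (simp add: algebra_simps)
qed

lemma blinfun_derivative_lipschitz:
  assumes "\<And>x. (f has_derivative blinfun_apply (f' x)) (at x)" and "\<And>x. norm (f' x) \<le> c"
  shows "norm (f x - f y) \<le> c * norm (x - y)"
  using assms by (intro differentiable_bound[of UNIV f "\<lambda>x. blinfun_apply (f' x)"])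
    (auto simp: norm_blinfun.rep_eq[symmetric])

text \<open>This makes the mean value inequality applicable to differences, and by iteration to
  differences of differences.\<close>

lemma blinfun_derivative_shift_minus:
  fixes f :: "'a::real_normed_vector \<Rightarrow> 'b::real_normed_vector"
  assumes "\<And>x. (f has_derivative blinfun_apply (f' x)) (at x)"
  shows "((\<lambda>x. f (x + a) - f x) has_derivative blinfun_apply (f' (x + a) - f' x)) (at x)"
proof -
  have "((\<lambda>x. f (x + a)) has_derivative blinfun_apply (f' (x + a))) (at x)"
  proof -
    have "((\<lambda>x. x + a) has_derivative (\<lambda>h. h)) (at x)" by (auto intro!: derivative_eq_intros)
    from diff_chain_at[OF this assms] show ?thesis by (simp add: o_def)
  qed
  from has_derivative_diff[OF this assms] show ?thesis
    by (rule has_derivative_eq_rhs) (simp add: fun_eq_iff blinfun.diff_left)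
qed

text \<open>Each increment costs one derivative by the mean value inequality, so three bounded
  derivatives allow the increments \<open>a\<close> and \<open>b\<close> and one Lipschitz estimate.
  The bounds serve \<open>norm_conv_le\<close> in consecutive pairs: the two middle ones are each
  the Lipschitz estimate for one difference of \<open>K\<close> and the supremum bound for the
  next.\<close>

lemma UCb3_difference_bounds:
  fixes K :: "real^'n \<Rightarrow> real^'n^'n"
  assumes "UCb3 K"
  obtains c where
    "\<And>z. norm (K z) \<le> c"
    "\<And>z y. norm (K z - K y) \<le> c * norm (z - y)"
    "\<And>z y a. norm ((K (z + a) - K z) - (K (y + a) - K y)) \<le> c * norm a * norm (z - y)"
    "\<And>z y a b. norm (((K (z + b + a) - K (z + b)) - (K (z + a) - K z)) -
        ((K (y + b + a) - K (y + b)) - (K (y + a) - K y))) \<le> c * norm a * norm b * norm (z - y)"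
proof -
  obtain K1 K2 K3 where d: "\<And>x. (K has_derivative blinfun_apply (K1 x)) (at x)"
      "\<And>x. (K1 has_derivative blinfun_apply (K2 x)) (at x)"
      "\<And>x. (K2 has_derivative blinfun_apply (K3 x)) (at x)"
    and b: "bounded (range K)" "bounded (range K1)" "bounded (range K2)" "bounded (range K3)"
    using assms unfolding UCb3_def by blast
  obtain c0 c1 c2 c3 where c: "\<And>x. norm (K x) \<le> c0" "\<And>x. norm (K1 x) \<le> c1"
      "\<And>x. norm (K2 x) \<le> c2" "\<And>x. norm (K3 x) \<le> c3"
    using b unfolding bounded_iff by auto
  define c where "c = max (max c0 c1) (max c2 c3)"
  have n: "norm (K x) \<le> c" "norm (K1 x) \<le> c" "norm (K2 x) \<le> c" "norm (K3 x) \<le> c" for x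
    using c[of x] unfolding c_def by linarith+
  note lip = blinfun_derivative_lipschitz
  have L0: "norm (K z - K y) \<le> c * norm (z - y)" for z y by (rule lip[OF d(1) n(2)])
  have "norm (K1 z - K1 y) \<le> c * norm (z - y)" for z y by (rule lip[OF d(2) n(3)])
  then have "norm (K1 (z + a) - K1 z) \<le> c * norm a" for z a by (metis add_diff_cancel_left')
  then have L1: "norm ((K (z + a) - K z) - (K (y + a) - K y)) \<le> c * norm a * norm (z - y)" for z y a
    by (rule lip[OF blinfun_derivative_shift_minus[OF d(1)]])
  have "norm (K2 z - K2 y) \<le> c * norm (z - y)" for z y by (rule lip[OF d(3) n(4)])
  then have "norm (K2 (z + a) - K2 z) \<le> c * norm a" for z a by (metis add_diff_cancel_left')
  then have "norm ((K1 (z + a) - K1 z) - (K1 (y + a) - K1 y)) \<le> c * norm a * norm (z - y)" for z y a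
    by (rule lip[OF blinfun_derivative_shift_minus[OF d(2)]])
  then have "norm ((K1 (z + b + a) - K1 (z + b)) - (K1 (z + a) - K1 z)) \<le> c * norm a * norm b" for z a b
    by (metis add_diff_cancel_left')
  then have L2: "norm (((K (z + b + a) - K (z + b)) - (K (z + a) - K z)) -
        ((K (y + b + a) - K (y + b)) - (K (y + a) - K y))) \<le> c * norm a * norm b * norm (z - y)" for z y a b
    by (rule lip[OF blinfun_derivative_shift_minus[OF blinfun_derivative_shift_minus[OF d(1)]]])
  show thesis by (rule that[OF n(1) L0 L1 L2])
qed

lemma UCb3_bcontfun: "UCb3 K \<Longrightarrow> K \<in> bcontfun"
  unfolding UCb3_def bcontfun_def
  by (auto intro!: uniformly_continuous_imp_continuous)

text \<open>Three derivatives of \<open>K\<close> suffice for two of \<open>K \<ast> \<xi>\<close>: the weak norm costs one Lipschitz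
  constant of the kernel.\<close>

lemma UCb3_conv_bounds:
  fixes K :: "real^'n \<Rightarrow> real^'n^'n"
  assumes "UCb3 K"
  obtains \<kappa> where "0 \<le> \<kappa>" "\<And>\<xi> x. norm (conv K \<xi> x) \<le> \<kappa> * wnorm \<xi>"
    "\<And>\<xi>. C11_bound (\<kappa> * wnorm \<xi>) (\<kappa> * wnorm \<xi>) (conv K \<xi>)"
proof -
  obtain c where c: "\<And>z. norm (K z) \<le> c"
    "\<And>z y. norm (K z - K y) \<le> c * norm (z - y)"
    "\<And>z y a. norm ((K (z + a) - K z) - (K (y + a) - K y)) \<le> c * norm a * norm (z - y)"
    "\<And>z y a b. norm (((K (z + b + a) - K (z + b)) - (K (z + a) - K z)) -
        ((K (y + b + a) - K (y + b)) - (K (y + a) - K y))) \<le> c * norm a * norm b * norm (z - y)"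
    using UCb3_difference_bounds[OF assms] by blast
  have c0: "0 \<le> c" using c(1)[of 0] norm_ge_zero order_trans by blast
  note Kb = UCb3_bcontfun[OF assms]
  define \<kappa> where "\<kappa> = real CARD('n) * 2 * c"
  show thesis
  proof (rule that[of \<kappa>])
    show "0 \<le> \<kappa>" using c0 by (simp add: \<kappa>_def)
    show "norm (conv K \<xi> x) \<le> \<kappa> * wnorm \<xi>" for \<xi> x
      unfolding \<kappa>_def by (rule norm_conv_le[OF c(1,2)])
    have d1: "conv K \<xi> (x + a) - conv K \<xi> x = conv (\<lambda>z. K (z + a) - K z) \<xi> x" for \<xi> x a
      by (simp add: conv_minus_kernel[OF shift_bcontfun[OF Kb] Kb] conv_shift)
    have "norm (conv K \<xi> (x + a) - conv K \<xi> x) \<le> \<kappa> * wnorm \<xi> * norm a" for \<xi> x a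
    proof -
      have "norm (K (z + a) - K z) \<le> c * norm a" for z using c(2)[of "z + a" z] by simp
      from norm_conv_le[OF this c(3), of \<xi> x] show ?thesis
        unfolding d1 by (simp add: \<kappa>_def algebra_simps)
    qed
    moreover have "norm (second_diff (conv K \<xi>) x b a) \<le> \<kappa> * wnorm \<xi> * norm b * norm a" for \<xi> x a b
    proof -
      let ?h = "\<lambda>z. K (z + a) - K z"
      have hb: "?h \<in> bcontfun" by (intro minus_cont shift_bcontfun Kb)
      have e: "second_diff (conv K \<xi>) x b a = conv ?h \<xi> (x + b) - conv ?h \<xi> x"
        unfolding second_diff_def d1[symmetric] by (simp add: algebra_simps)
      also have "\<dots> = conv (\<lambda>z. ?h (z + b) - ?h z) \<xi> x"
        unfolding conv_minus_kernel[OF shift_bcontfun[OF hb] hb] by (simp add: conv_shift)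
      finally have e: "second_diff (conv K \<xi>) x b a = conv (\<lambda>z. ?h (z + b) - ?h z) \<xi> x" .
      have "norm (?h (z + b) - ?h z) \<le> c * norm a * norm b" for z
        using c(3)[of "z + b" a z] by simp
      from norm_conv_le[OF this c(4), of \<xi> x] show ?thesis
        unfolding e by (simp add: \<kappa>_def algebra_simps)
    qed
    ultimately show "C11_bound (\<kappa> * wnorm \<xi>) (\<kappa> * wnorm \<xi>) (conv K \<xi>)" for \<xi>
      unfolding C11_bound_def by blast
  qed
qed

section \<open>Flows: regularity and dependence on the vector field\<close>

text \<open>The point \<open>q + r - s\<close> completes a parallelogram with \<open>q\<close>,
  \<open>r\<close>, \<open>s\<close>: there the second-difference bound applies, and moving from it
  to \<open>p\<close> costs the Lipschitz term. This takes the place of the chain rule in estimates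
  of second differences of trajectories.\<close>

lemma C11_bound_four_points:
  assumes "C11_bound L H v"
  shows "norm (v p - v q - v r + v s) \<le> L * norm (p - q - r + s) + H * norm (q - s) * norm (r - s)"
proof -
  have "v p - v q - v r + v s = (v p - v (q + r - s)) + second_diff v s (q - s) (r - s)"
    unfolding second_diff_def by (simp add: algebra_simps)
  also have "norm \<dots> \<le> L * norm (p - (q + r - s)) + H * norm (q - s) * norm (r - s)"
    by (intro norm_triangle_le add_mono C11_boundD[OF assms])
  also have "p - (q + r - s) = p - q - r + s" by simp
  finally show ?thesis .
qed

lemma is_flowD:
  assumes "is_flow v T \<phi>"
  shows "\<phi> 0 x = x"
    and "t \<in> {0..T} \<Longrightarrow> ((\<lambda>s. \<phi> s x) has_vector_derivative v t (\<phi> t x)) (at t within {0..T})"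
  using assms unfolding is_flow_def by auto

text \<open>In the stability argument the driving fields are controlled only up to a time
  \<open>r\<close>, so the flows are restricted to shorter intervals.\<close>

lemma is_flow_subinterval:
  assumes "is_flow v T \<phi>" "\<tau> \<le> T"
  shows "is_flow v \<tau> \<phi>"
  unfolding is_flow_def
proof (intro allI conjI ballI)
  fix x t assume "t \<in> {0..\<tau>}"
  then show "((\<lambda>s. \<phi> s x) has_vector_derivative v t (\<phi> t x)) (at t within {0..\<tau>})"
    using assms by (intro has_vector_derivative_within_subset[OF is_flowD(2)[OF assms(1)]]) auto
qed (rule is_flowD(1)[OF assms(1)])

lemma flow_lipschitz:
  assumes flow: "is_flow v \<tau> \<phi>" and v: "\<And>t. t \<in> {0..\<tau>} \<Longrightarrow> C11_bound L L (v t)"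
    and L: "0 \<le> L" and t: "t \<in> {0..\<tau>}"
  shows "norm (\<phi> t y - \<phi> t x) \<le> exp (L * t) * norm (y - x)"
proof -
  have "norm (\<phi> t y - \<phi> t x) \<le> norm (y - x) * exp (L * t)"
  proof (rule exp_comparison[where A = 0 and L = L, OF _ _ _ _ _ _ t])
    fix r assume r: "r \<in> {0..\<tau>}"
    show "((\<lambda>s. \<phi> s y - \<phi> s x) has_vector_derivative v r (\<phi> r y) - v r (\<phi> r x)) (at r within {0..\<tau>})"
      by (intro has_vector_derivative_diff is_flowD(2)[OF flow r])
    show "norm (v r (\<phi> r y) - v r (\<phi> r x)) \<le> 0 * exp (L * r) + L * norm (\<phi> r y - \<phi> r x)"
      using C11_boundD(1)[OF v[OF r]] by simp
  qed (use L is_flowD(1)[OF flow] in auto)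
  then show ?thesis by (simp add: mult.commute)
qed

text \<open>By \<open>C11_bound_four_points\<close> the second difference of trajectories grows at
  rate \<open>L\<close>, with a source made of two first differences that each grow like
  \<open>exp (L * t)\<close>. With rate \<open>2 * L\<close> and \<open>c = norm a * norm b\<close>
  the condition of \<open>exp_comparison\<close> is an equality.\<close>

lemma flow_C11_bound:
  assumes flow: "is_flow v \<tau> \<phi>" and v: "\<And>t. t \<in> {0..\<tau>} \<Longrightarrow> C11_bound L L (v t)"
    and L: "0 \<le> L" and t: "t \<in> {0..\<tau>}"
  shows "C11_bound (exp (L * t)) (exp (2 * L * t)) (\<phi> t)"
  unfolding C11_bound_def
proof (intro conjI allI)
  note lip = flow_lipschitz[OF flow v L]
  show "norm (\<phi> t (x + a) - \<phi> t x) \<le> exp (L * t) * norm a" for x a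
    using lip[OF _ t, of "x + a" x] by simp
  fix x a b :: "real^'a"
  have "norm (\<phi> t (x + a + b) - \<phi> t (x + a) - \<phi> t (x + b) + \<phi> t x)
      \<le> (norm a * norm b) * exp (2 * L * t)"
  proof (rule exp_comparison[where A = "L * norm a * norm b" and L = L, OF _ _ _ _ _ _ t])
    fix r assume r: "r \<in> {0..\<tau>}"
    show "((\<lambda>s. \<phi> s (x + a + b) - \<phi> s (x + a) - \<phi> s (x + b) + \<phi> s x) has_vector_derivative
        v r (\<phi> r (x + a + b)) - v r (\<phi> r (x + a)) - v r (\<phi> r (x + b)) + v r (\<phi> r x)) (at r within {0..\<tau>})"
      by (intro has_vector_derivative_diff has_vector_derivative_add is_flowD(2)[OF flow r])
    have "norm (\<phi> r (x + a) - \<phi> r x) \<le> exp (L * r) * norm a"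
      "norm (\<phi> r (x + b) - \<phi> r x) \<le> exp (L * r) * norm b"
      using lip[OF _ r, of "x + a" x] lip[OF _ r, of "x + b" x] by auto
    then have "L * norm (\<phi> r (x + a) - \<phi> r x) * norm (\<phi> r (x + b) - \<phi> r x)
        \<le> L * (exp (L * r) * norm a) * (exp (L * r) * norm b)"
      using L by (intro mult_mono) auto
    also have "\<dots> = L * norm a * norm b * exp (2 * L * r)"
    proof -
      have "exp (2 * L * r) = exp (L * r) * exp (L * r)" by (simp add: exp_add[symmetric] algebra_simps)
      then show ?thesis by simp
    qed
    finally show "norm (v r (\<phi> r (x + a + b)) - v r (\<phi> r (x + a)) - v r (\<phi> r (x + b)) + v r (\<phi> r x))
        \<le> L * norm a * norm b * exp (2 * L * r)
          + L * norm (\<phi> r (x + a + b) - \<phi> r (x + a) - \<phi> r (x + b) + \<phi> r x)"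
      using C11_bound_four_points[OF v[OF r], of "\<phi> r (x + a + b)" "\<phi> r (x + a)" "\<phi> r (x + b)" "\<phi> r x"]
      by linarith
  next
    show "norm (\<phi> 0 (x + a + b) - \<phi> 0 (x + a) - \<phi> 0 (x + b) + \<phi> 0 x) \<le> norm a * norm b"
      by (simp add: is_flowD(1)[OF flow])
  qed (use L in auto)
  then show "norm (second_diff (\<phi> t) x a b) \<le> exp (2 * L * t) * norm a * norm b"
    unfolding second_diff_def by (simp add: mult_ac)
qed

text \<open>Measured with the weight \<open>exp (\<mu> * t)\<close>, a perturbation of the field by
  \<open>D\<close> moves the flow only by \<open>D / (\<mu> - L)\<close>, which is small for large
  \<mu>. Comparing two starting points also brings in the Lipschitz growth of the flows, hence the
  rate \<open>\<mu> + L\<close>.\<close>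

lemma flow_difference_bounds:
  assumes \<phi>: "is_flow v \<tau> \<phi>" and \<psi>: "is_flow w \<tau> \<psi>"
    and v: "\<And>t. t \<in> {0..\<tau>} \<Longrightarrow> C11_bound L L (v t)"
    and w: "\<And>t. t \<in> {0..\<tau>} \<Longrightarrow> C11_bound L L (w t)"
    and sup: "\<And>t x. t \<in> {0..\<tau>} \<Longrightarrow> norm (w t x - v t x) \<le> D * exp (\<mu> * t)"
    and lip: "\<And>t x y. t \<in> {0..\<tau>} \<Longrightarrow>
      norm ((w t y - v t y) - (w t x - v t x)) \<le> D * exp (\<mu> * t) * norm (y - x)"
    and L: "0 \<le> L" "L < \<mu>" and D: "0 \<le> D" and t: "t \<in> {0..\<tau>}"
  shows "norm (\<psi> t x - \<phi> t x) \<le> D / (\<mu> - L) * exp (\<mu> * t)"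
    and "norm ((\<psi> t y - \<phi> t y) - (\<psi> t x - \<phi> t x)) \<le> D / (\<mu> - L) * exp ((\<mu> + L) * t) * norm (y - x)"
proof -
  \<comment> \<open>The borderline constant of \<open>exp_comparison\<close> with source
    \<open>D\<close> and zero initial value.\<close>
  have c: "D + L * (D / (\<mu> - L)) = \<mu> * (D / (\<mu> - L))"
    using L by (simp add: field_simps)
  have 1: "norm (\<psi> t x - \<phi> t x) \<le> D / (\<mu> - L) * exp (\<mu> * t)" if t: "t \<in> {0..\<tau>}" for t x
  proof (rule exp_comparison[where A = D and L = L, OF _ _ _ _ _ _ t])
    fix r assume r: "r \<in> {0..\<tau>}"
    show "((\<lambda>s. \<psi> s x - \<phi> s x) has_vector_derivative w r (\<psi> r x) - v r (\<phi> r x)) (at r within {0..\<tau>})"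
      by (intro has_vector_derivative_diff is_flowD(2)[OF \<phi> r] is_flowD(2)[OF \<psi> r])
    have "w r (\<psi> r x) - v r (\<phi> r x) = (w r (\<psi> r x) - v r (\<psi> r x)) + (v r (\<psi> r x) - v r (\<phi> r x))" by simp
    then show "norm (w r (\<psi> r x) - v r (\<phi> r x)) \<le> D * exp (\<mu> * r) + L * norm (\<psi> r x - \<phi> r x)"
      using norm_triangle_mono[OF sup[OF r] C11_boundD(1)[OF v[OF r]]] by metis
  qed (use L D c is_flowD(1)[OF \<phi>] is_flowD(1)[OF \<psi>] in auto)
  then show "norm (\<psi> t x - \<phi> t x) \<le> D / (\<mu> - L) * exp (\<mu> * t)" using t .
  define B where "B = D / (\<mu> - L)"
  have B: "0 \<le> B" "D + L * B = \<mu> * B" using L D c by (auto simp: B_def)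
  have "norm (\<psi> t y - \<psi> t x - \<phi> t y + \<phi> t x) \<le> (B * norm (y - x)) * exp ((\<mu> + L) * t)"
  \<comment> \<open>The sources from \<open>w - v\<close> and from the displacement \<open>B\<close>
    add up to \<open>(D + L * B) * norm (y - x)\<close>, which is
    \<open>\<mu> * B * norm (y - x)\<close>.\<close>
  proof (rule exp_comparison[where A = "\<mu> * B * norm (y - x)" and L = L, OF _ _ _ _ _ _ t])
    fix r assume r: "r \<in> {0..\<tau>}"
    show "((\<lambda>s. \<psi> s y - \<psi> s x - \<phi> s y + \<phi> s x) has_vector_derivative
        w r (\<psi> r y) - w r (\<psi> r x) - v r (\<phi> r y) + v r (\<phi> r x)) (at r within {0..\<tau>})"
      by (intro has_vector_derivative_diff has_vector_derivative_add is_flowD(2)[OF \<phi> r] is_flowD(2)[OF \<psi> r])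
    let ?n = "norm (y - x)" and ?e = "exp (\<mu> * r)" and ?f = "exp (L * r)"
    have "norm ((w r (\<psi> r y) - v r (\<psi> r y)) - (w r (\<psi> r x) - v r (\<psi> r x)))
        \<le> D * ?e * norm (\<psi> r y - \<psi> r x)" by (rule lip[OF r])
    also have "\<dots> \<le> D * ?e * (?f * ?n)"
      using D flow_lipschitz[OF \<psi> w L(1) r] by (intro mult_left_mono) auto
    finally have a: "norm ((w r (\<psi> r y) - v r (\<psi> r y)) - (w r (\<psi> r x) - v r (\<psi> r x))) \<le> D * ?e * (?f * ?n)" .
    have "norm (v r (\<psi> r y) - v r (\<psi> r x) - v r (\<phi> r y) + v r (\<phi> r x))
        \<le> L * norm (\<psi> r y - \<psi> r x - \<phi> r y + \<phi> r x) + L * norm (\<psi> r x - \<phi> r x) * norm (\<phi> r y - \<phi> r x)"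
      by (rule C11_bound_four_points[OF v[OF r]])
    also have "\<dots> \<le> L * norm (\<psi> r y - \<psi> r x - \<phi> r y + \<phi> r x) + L * (B * ?e) * (?f * ?n)"
      using L B 1[OF r, folded B_def, of x] flow_lipschitz[OF \<phi> v L(1) r]
      by (intro add_left_mono mult_mono) auto
    finally have b: "norm (v r (\<psi> r y) - v r (\<psi> r x) - v r (\<phi> r y) + v r (\<phi> r x))
        \<le> L * norm (\<psi> r y - \<psi> r x - \<phi> r y + \<phi> r x) + L * (B * ?e) * (?f * ?n)" .
    \<comment> \<open>The perturbation \<open>w - v\<close> is evaluated at points of
      \<open>\<psi>\<close> only; what remains involves \<open>v\<close> alone and is a four-point
      difference.\<close>
    have "w r (\<psi> r y) - w r (\<psi> r x) - v r (\<phi> r y) + v r (\<phi> r x)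
      = ((w r (\<psi> r y) - v r (\<psi> r y)) - (w r (\<psi> r x) - v r (\<psi> r x)))
        + (v r (\<psi> r y) - v r (\<psi> r x) - v r (\<phi> r y) + v r (\<phi> r x))" by simp
    then have "norm (w r (\<psi> r y) - w r (\<psi> r x) - v r (\<phi> r y) + v r (\<phi> r x))
      \<le> D * ?e * (?f * ?n) + (L * norm (\<psi> r y - \<psi> r x - \<phi> r y + \<phi> r x) + L * (B * ?e) * (?f * ?n))"
      using norm_triangle_mono[OF a b] by (simp only:)
    also have "\<dots> = (D + L * B) * ?n * (?e * ?f) + L * norm (\<psi> r y - \<psi> r x - \<phi> r y + \<phi> r x)"
      by (simp add: algebra_simps)
    also have "?e * ?f = exp ((\<mu> + L) * r)" by (simp add: exp_add[symmetric] algebra_simps)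
    finally show "norm (w r (\<psi> r y) - w r (\<psi> r x) - v r (\<phi> r y) + v r (\<phi> r x))
      \<le> \<mu> * B * ?n * exp ((\<mu> + L) * r) + L * norm (\<psi> r y - \<psi> r x - \<phi> r y + \<phi> r x)"
      unfolding B(2) .
  next
    show "norm (\<psi> 0 y - \<psi> 0 x - \<phi> 0 y + \<phi> 0 x) \<le> B * norm (y - x)"
      using B by (simp add: is_flowD(1)[OF \<phi>] is_flowD(1)[OF \<psi>])
  qed (use L B in \<open>auto simp: algebra_simps\<close>)
  moreover have "(\<psi> t y - \<phi> t y) - (\<psi> t x - \<phi> t x) = \<psi> t y - \<psi> t x - \<phi> t y + \<phi> t x" by simp
  ultimately show "norm ((\<psi> t y - \<phi> t y) - (\<psi> t x - \<phi> t x)) \<le> D / (\<mu> - L) * exp ((\<mu> + L) * t) * norm (y - x)"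
    unfolding B_def by (simp only: mult_ac)
qed

section \<open>Derivative bounds and push-forward\<close>

lemma C11_bound_has_derivative:
  fixes f :: "'a::real_normed_vector \<Rightarrow> 'b::banach"
  assumes "C11_bound L H f"
  shows "(f has_derivative frechet_derivative f (at x)) (at x)"
  using C11_bound_differentiable[OF assms] frechet_derivative_works by blast

text \<open>First differences bound the derivative. The increments of \<open>f (z + b) - f z\<close>
  in \<open>z\<close> are second differences, so they bound its derivative, which is the difference
  of the derivatives of \<open>f\<close> at two points.\<close>

lemma C11_bound_derivative_bounds:
  fixes f :: "'a::real_normed_vector \<Rightarrow> 'b::banach"
  assumes f: "C11_bound L H f"
  shows "norm (frechet_derivative f (at x) a) \<le> L * norm a"
    and "norm (frechet_derivative f (at y) a - frechet_derivative f (at x) a) \<le> H * norm (y - x) * norm a"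
proof -
  note d = C11_bound_has_derivative[OF f]
  show "norm (frechet_derivative f (at x) a) \<le> L * norm a"
    using f unfolding C11_bound_def by (intro has_derivative_norm_le[OF d]) blast
  define b where "b = y - x"
  have "((\<lambda>z. z + b) has_derivative (\<lambda>h. h)) (at x)" by (auto intro!: derivative_eq_intros)
  from diff_chain_at[OF this d] have "((\<lambda>z. f (z + b)) has_derivative frechet_derivative f (at y)) (at x)"
    by (simp add: o_def b_def)
  from has_derivative_diff[OF this d]
  have "((\<lambda>z. f (z + b) - f z) has_derivative
      (\<lambda>a. frechet_derivative f (at y) a - frechet_derivative f (at x) a)) (at x)" .
  then show "norm (frechet_derivative f (at y) a - frechet_derivative f (at x) a) \<le> H * norm (y - x) * norm a"
  proof (rule has_derivative_norm_le)
    fix a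
    have "f (x + a + b) - f (x + a) - (f (x + b) - f x) = second_diff f x a b"
      by (simp add: second_diff_def)
    then show "norm (f (x + a + b) - f (x + a) - (f (x + b) - f x)) \<le> H * norm (y - x) * norm a"
      using C11_boundD(2)[OF f, of x a b] by (simp add: b_def mult_ac)
  qed
qed

lemma C11_bound_derivative_difference:
  fixes f g :: "'a::real_normed_vector \<Rightarrow> 'b::banach"
  assumes f: "C11_bound L H f" and g: "C11_bound L' H' g"
    and le: "\<And>x y. norm ((g y - f y) - (g x - f x)) \<le> c * norm (y - x)"
  shows "norm (frechet_derivative g (at x) a - frechet_derivative f (at x) a) \<le> c * norm a"
proof (rule has_derivative_norm_le[OF has_derivative_diff[OF
      C11_bound_has_derivative[OF g] C11_bound_has_derivative[OF f]]])
  show "norm (g (x + a) - f (x + a) - (g x - f x)) \<le> c * norm a" for a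
    using le[of "x + a" x] by simp
qed

text \<open>Testing against \<open>a\<close> trades the transposed Jacobian for the Frechet
  derivative, to which the difference bounds apply; \<open>norm_le_inner_bound\<close> then recovers
  norms.\<close>

lemma inner_transpose_jacobian:
  fixes f :: "real^'n \<Rightarrow> real^'n"
  assumes "C11_bound L H f"
  shows "(transpose (jacobian f (at x)) *v w) \<bullet> a = w \<bullet> frechet_derivative f (at x) a"
proof -
  have "jacobian f (at x) *v a = frechet_derivative f (at x) a"
    unfolding jacobian_def
    using matrix_works[of "frechet_derivative f (at x)"] has_derivative_linear[OF C11_bound_has_derivative[OF assms]]
    by (simp add: linear_matrix_vector_mul_eq)
  then show ?thesis by (simp add: dot_lmul_matrix)
qed

lemma norm_le_inner_bound:
  fixes y :: "'a::real_inner"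
  assumes "0 \<le> c" "\<And>a. y \<bullet> a \<le> c * norm a"
  shows "norm y \<le> c"
proof (cases "y = 0")
  case False
  have "norm y * norm y \<le> c * norm y"
    using assms(2)[of y] by (simp add: dot_square_norm power2_eq_square)
  then show ?thesis using False by simp
qed (use assms in simp)

context
  fixes \<phi> :: "real^'n \<Rightarrow> real^'n" and G H :: real
  assumes \<phi>: "C11_bound G H \<phi>" and G: "0 \<le> G" and H: "0 \<le> H"
begin

lemma norm_transpose_jacobian_le:
  "norm (transpose (jacobian \<phi> (at x)) *v w) \<le> G * norm w"
proof (rule norm_le_inner_bound)
  fix a
  have "w \<bullet> frechet_derivative \<phi> (at x) a \<le> norm w * (G * norm a)"
    by (rule order_trans[OF norm_cauchy_schwarz mult_left_mono[OF C11_bound_derivative_bounds(1)[OF \<phi>] norm_ge_zero]])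
  then show "(transpose (jacobian \<phi> (at x)) *v w) \<bullet> a \<le> G * norm w * norm a"
    by (simp only: inner_transpose_jacobian[OF \<phi>] mult_ac)
qed (use G in simp)

text \<open>\<open>Bcontfun\<close> returns the intended function only on \<open>bcontfun\<close>,
  so this is what makes \<open>push_test\<close> computable. Continuity is checked by components,
  with the derivative taken in one fixed direction at a time.\<close>

lemma push_test_bcontfun:
  "(\<lambda>x. transpose (jacobian \<phi> (at x)) *v apply_bcontfun \<theta> (\<phi> x)) \<in> bcontfun"
proof (rule bcontfun_normI)
  have "norm (\<phi> y - \<phi> x) \<le> G * norm (y - x)" for x y by (rule C11_boundD(1)[OF \<phi>])
  then have "G-lipschitz_on UNIV \<phi>" using G by (auto intro!: lipschitz_onI simp: dist_norm)
  then have c\<phi>: "continuous_on UNIV \<phi>" by (rule lipschitz_on_continuous_on)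
  have "(H * norm a)-lipschitz_on UNIV (\<lambda>x. frechet_derivative \<phi> (at x) a)" for a
    using C11_bound_derivative_bounds(2)[OF \<phi>] H
    by (intro lipschitz_onI) (auto simp: dist_norm mult_ac)
  then have cD: "continuous_on UNIV (\<lambda>x. frechet_derivative \<phi> (at x) a)" for a
    by (rule lipschitz_on_continuous_on)
  have "(\<lambda>x. transpose (jacobian \<phi> (at x)) *v apply_bcontfun \<theta> (\<phi> x))
      = (\<lambda>x. \<chi> i. apply_bcontfun \<theta> (\<phi> x) \<bullet> frechet_derivative \<phi> (at x) (axis i 1))"
    using inner_transpose_jacobian[OF \<phi>, symmetric] by (simp add: fun_eq_iff vec_eq_iff inner_axis)
  moreover have "continuous_on UNIV
      (\<lambda>x. \<chi> i. apply_bcontfun \<theta> (\<phi> x) \<bullet> frechet_derivative \<phi> (at x) (axis i 1))"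
    by (intro continuous_intros cD continuous_on_compose2[OF continuous_on_apply_bcontfun c\<phi>]) auto
  ultimately show "continuous_on UNIV (\<lambda>x. transpose (jacobian \<phi> (at x)) *v apply_bcontfun \<theta> (\<phi> x))"
    by (simp only:)
  show "norm (transpose (jacobian \<phi> (at x)) *v apply_bcontfun \<theta> (\<phi> x)) \<le> G * norm \<theta>" for x
    by (rule order_trans[OF norm_transpose_jacobian_le mult_left_mono[OF norm_bounded G]])
qed

lemma push_test_apply:
  "apply_bcontfun (push_test \<phi> \<theta>) x = transpose (jacobian \<phi> (at x)) *v apply_bcontfun \<theta> (\<phi> x)"
  unfolding push_test_def Bcontfun_inverse[OF push_test_bcontfun] ..

lemma inner_push_test:
  "apply_bcontfun (push_test \<phi> \<theta>) x \<bullet> a = apply_bcontfun \<theta> (\<phi> x) \<bullet> frechet_derivative \<phi> (at x) a"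
  unfolding push_test_apply by (rule inner_transpose_jacobian[OF \<phi>])

lemma norm_push_test_le: "norm (push_test \<phi> \<theta>) \<le> G * norm \<theta>"
  unfolding push_test_apply
  by (rule norm_bound, unfold push_test_apply)
    (rule order_trans[OF norm_transpose_jacobian_le mult_left_mono[OF norm_bounded G]])

text \<open>Likewise \<open>Blinfun\<close> represents a functional only once it is bounded and
  linear; the bound comes from \<open>norm_push_test_le\<close>.\<close>

lemma push_apply: "blinfun_apply (push \<phi> \<xi>) \<theta> = blinfun_apply \<xi> (push_test \<phi> \<theta>)"
proof -
  have "bounded_linear (push_test \<phi>)"
  proof (rule bounded_linear_intro)
    show "push_test \<phi> (\<theta> + \<eta>) = push_test \<phi> \<theta> + push_test \<phi> \<eta>" for \<theta> \<eta>
      by (rule bcontfun_eqI) (simp add: push_test_apply matrix_vector_right_distrib)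
    show "push_test \<phi> (c *\<^sub>R \<theta>) = c *\<^sub>R push_test \<phi> \<theta>" for c \<theta>
      by (rule bcontfun_eqI) (simp add: push_test_apply matrix_vector_mult_scaleR)
    show "norm (push_test \<phi> \<theta>) \<le> norm \<theta> * G" for \<theta>
      using norm_push_test_le by (simp add: mult.commute)
  qed
  then have "bounded_linear (\<lambda>\<theta>. blinfun_apply \<xi> (push_test \<phi> \<theta>))"
    by (rule bounded_linear_compose[OF blinfun.bounded_linear_right])
  then show ?thesis unfolding push_def by (simp add: bounded_linear_Blinfun_apply)
qed

text \<open>A product estimate: the derivative has Lipschitz constant \<open>H\<close> against
  \<open>norm \<theta>\<close>, and \<open>\<theta>\<close> composed with \<open>\<phi>\<close> has
  constant \<open>G * l\<close> against a derivative bounded by \<open>G\<close>.\<close>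

lemma push_test_lipschitz:
  assumes l: "l-lipschitz_on UNIV (apply_bcontfun \<theta>)"
  shows "(H * norm \<theta> + G * G * l)-lipschitz_on UNIV (apply_bcontfun (push_test \<phi> \<theta>))"
proof (rule lipschitz_onI)
  have l0: "0 \<le> l" using lipschitz_on_nonneg[OF l] .
  show nn: "0 \<le> H * norm \<theta> + G * G * l" using G H l0 by simp
  fix x y
  have "norm (apply_bcontfun (push_test \<phi> \<theta>) x - apply_bcontfun (push_test \<phi> \<theta>) y)
      \<le> (H * norm \<theta> + G * G * l) * norm (x - y)"
  proof (rule norm_le_inner_bound)
    fix a
    let ?D = "\<lambda>x. frechet_derivative \<phi> (at x) a" and ?t = "\<lambda>x. apply_bcontfun \<theta> (\<phi> x)"
    have "?t x \<bullet> (?D x - ?D y) \<le> norm \<theta> * (H * norm (x - y) * norm a)"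
      by (rule order_trans[OF norm_cauchy_schwarz]) 
        (intro mult_mono norm_bounded C11_bound_derivative_bounds(2)[OF \<phi>]; simp)
    moreover have "(?t x - ?t y) \<bullet> ?D y \<le> (l * (G * norm (x - y))) * (G * norm a)"
    proof (rule order_trans[OF norm_cauchy_schwarz mult_mono])
      have "norm (?t x - ?t y) \<le> l * norm (\<phi> x - \<phi> y)"
        using lipschitz_onD[OF l, of "\<phi> x" "\<phi> y"] by (simp add: dist_norm)
      also have "\<dots> \<le> l * (G * norm (x - y))"
        using l0 C11_boundD(1)[OF \<phi>] by (intro mult_left_mono)
      finally show "norm (?t x - ?t y) \<le> l * (G * norm (x - y))" .
    qed (use G l0 C11_bound_derivative_bounds(1)[OF \<phi>] in auto)
    moreover have "(apply_bcontfun (push_test \<phi> \<theta>) x - apply_bcontfun (push_test \<phi> \<theta>) y) \<bullet> a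
      = ?t x \<bullet> (?D x - ?D y) + (?t x - ?t y) \<bullet> ?D y"
      by (simp add: inner_push_test inner_diff_left inner_diff_right)
    ultimately show "(apply_bcontfun (push_test \<phi> \<theta>) x - apply_bcontfun (push_test \<phi> \<theta>) y) \<bullet> a
       \<le> (H * norm \<theta> + G * G * l) * norm (x - y) * norm a"
      by (simp add: algebra_simps)
  qed (use nn in simp)
  then show "dist (apply_bcontfun (push_test \<phi> \<theta>) x) (apply_bcontfun (push_test \<phi> \<theta>) y)
      \<le> (H * norm \<theta> + G * G * l) * dist x y" by (simp add: dist_norm)
qed

end

text \<open>The difference \<open>\<psi>\<^sub>\<sharp> \<eta> - \<phi>\<^sub>\<sharp> \<xi>\<close> splits into \<open>\<psi>\<^sub>\<sharp> (\<eta> - \<xi>)\<close>, controlled by the weak norm, and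
  \<open>(\<psi>\<^sub>\<sharp> - \<phi>\<^sub>\<sharp>) \<xi>\<close>, where the test functions are only small in the supremum norm and the mass of
  \<open>\<xi>\<close> enters; the masses of the approximating currents need not be bounded.\<close>

lemma wdist_push_le:
  fixes \<phi> \<psi> :: "real^'n \<Rightarrow> real^'n"
  assumes \<phi>: "C11_bound G H \<phi>" and \<psi>: "C11_bound G H \<psi>" and G: "0 \<le> G" and H: "0 \<le> H"
    and B: "\<And>x. norm (\<psi> x - \<phi> x) \<le> B"
    and B': "\<And>x y. norm ((\<psi> y - \<phi> y) - (\<psi> x - \<phi> x)) \<le> B' * norm (y - x)"
    and B'0: "0 \<le> B'"
  shows "wdist (push \<psi> \<eta>) (push \<phi> \<xi>) \<le> wdist \<eta> \<xi> * (G + H + G * G) + norm \<xi> * (B' + G * B)"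
  unfolding wdist_def
proof (rule wnorm_le)
  fix \<theta> :: "(real^'n) \<Rightarrow>\<^sub>C (real^'n)" and l
  assume l: "l-lipschitz_on UNIV (apply_bcontfun \<theta>)" and le: "norm \<theta> + l \<le> 1"
  have l0: "0 \<le> l" using lipschitz_on_nonneg[OF l] .
  have n1: "norm \<theta> \<le> 1" "l \<le> 1" using l0 le norm_ge_zero[of \<theta>] by linarith+
  have B0: "0 \<le> B" using B[of 0] norm_ge_zero order_trans by blast
  let ?P = "push_test \<psi> \<theta>" and ?Q = "push_test \<phi> \<theta>"
  \<comment> \<open>\<open>B'\<close> comes from the change of the derivative, \<open>G * B\<close>
    from the displacement of the point where \<open>\<theta>\<close> is evaluated.\<close>
  have "norm (?P - ?Q) \<le> B' + G * B"
  proof (rule norm_bound)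
    fix x
    show "norm (apply_bcontfun (?P - ?Q) x) \<le> B' + G * B"
    proof (rule norm_le_inner_bound)
      show "0 \<le> B' + G * B" using B0 B'0 G by simp
      fix a
      let ?D = "frechet_derivative \<psi> (at x) a" and ?E = "frechet_derivative \<phi> (at x) a"
      have "apply_bcontfun \<theta> (\<psi> x) \<bullet> (?D - ?E) \<le> 1 * (B' * norm a)"
        using C11_bound_derivative_difference[OF \<phi> \<psi> B'] norm_bounded[of \<theta> "\<psi> x"] n1
        by (intro order_trans[OF norm_cauchy_schwarz] mult_mono) auto
      moreover have "(apply_bcontfun \<theta> (\<psi> x) - apply_bcontfun \<theta> (\<phi> x)) \<bullet> ?E \<le> (1 * B) * (G * norm a)"
      proof (rule order_trans[OF norm_cauchy_schwarz mult_mono])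
        have "norm (apply_bcontfun \<theta> (\<psi> x) - apply_bcontfun \<theta> (\<phi> x)) \<le> l * norm (\<psi> x - \<phi> x)"
          using lipschitz_onD[OF l, of "\<psi> x" "\<phi> x"] by (simp add: dist_norm)
        also have "\<dots> \<le> 1 * B" using n1 l0 B by (intro mult_mono) auto
        finally show "norm (apply_bcontfun \<theta> (\<psi> x) - apply_bcontfun \<theta> (\<phi> x)) \<le> 1 * B" .
      qed (use B0 C11_bound_derivative_bounds(1)[OF \<phi>] in auto)
      moreover have "apply_bcontfun (?P - ?Q) x \<bullet> a = apply_bcontfun \<theta> (\<psi> x) \<bullet> (?D - ?E)
          + (apply_bcontfun \<theta> (\<psi> x) - apply_bcontfun \<theta> (\<phi> x)) \<bullet> ?E"
        by (simp add: inner_push_test[OF \<phi> G H] inner_push_test[OF \<psi> G H] inner_diff_left inner_diff_right)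
      ultimately show "apply_bcontfun (?P - ?Q) x \<bullet> a \<le> (B' + G * B) * norm a"
        by (simp add: algebra_simps)
    qed
  qed
  then have "norm \<xi> * norm (?P - ?Q) \<le> norm \<xi> * (B' + G * B)" by (intro mult_left_mono) auto
  then have 2: "blinfun_apply \<xi> (?P - ?Q) \<le> norm \<xi> * (B' + G * B)"
    using norm_blinfun[of \<xi> "?P - ?Q"] by simp
  have "blinfun_apply (\<eta> - \<xi>) ?P \<le> wnorm (\<eta> - \<xi>) * (G * norm \<theta> + (H * norm \<theta> + G * G * l))"
    using abs_blinfun_apply_le_wnorm[OF push_test_lipschitz[OF \<psi> G H l] norm_push_test_le[OF \<psi> G H]]
    by (metis abs_le_D1)
  also have "\<dots> \<le> wnorm (\<eta> - \<xi>) * (G * 1 + (H * 1 + G * G * 1))"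
    using n1 G H wnorm_nonneg by (intro mult_left_mono add_mono) auto
  finally have 1: "blinfun_apply (\<eta> - \<xi>) ?P \<le> wnorm (\<eta> - \<xi>) * (G + H + G * G)" by (simp add: add.assoc)
  have "blinfun_apply (push \<psi> \<eta> - push \<phi> \<xi>) \<theta> = blinfun_apply (\<eta> - \<xi>) ?P + blinfun_apply \<xi> (?P - ?Q)"
    by (simp add: push_apply[OF \<phi> G H] push_apply[OF \<psi> G H] blinfun.diff_left blinfun.diff_right)
  then show "blinfun_apply (push \<psi> \<eta> - push \<phi> \<xi>) \<theta>
      \<le> wnorm (\<eta> - \<xi>) * (G + H + G * G) + norm \<xi> * (B' + G * B)"
    using 1 2 by simp
qed

section \<open>Stability of solutions in the weak distance\<close>

lemma C11_bound_mono:
  fixes f :: "'a::real_normed_vector \<Rightarrow> 'b::real_normed_vector"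
  assumes "C11_bound L H f" "L \<le> L'" "H \<le> H'"
  shows "C11_bound L' H' f"
  unfolding C11_bound_def
proof (intro conjI allI)
  fix x a b :: 'a
  have "L * norm a \<le> L' * norm a" "H * (norm a * norm b) \<le> H' * (norm a * norm b)"
    using assms by (auto intro!: mult_right_mono)
  then show "norm (f (x + a) - f x) \<le> L' * norm a"
    "norm (second_diff f x a b) \<le> H' * norm a * norm b"
    using C11_boundD(1)[OF assms(1), of "x + a" x] C11_boundD(2)[OF assms(1), of x a b]
    by (auto simp: mult.assoc)
qed

text \<open>\<open>C\<close> and \<open>\<mu>\<close> are fixed before \<open>\<eta>\<close>, so one
  estimate serves a whole sequence of solutions. Keeping the bound below 1 keeps the weak norm of
  \<open>\<eta> s\<close> at most \<open>M + 1\<close> as long as the bound holds, so that a single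
  constant \<open>L\<close> governs both flows.\<close>

theorem solution_stability:
  fixes K :: "real^'n \<Rightarrow> real^'n^'n" and \<xi> :: "real \<Rightarrow> 'n current"
  assumes K: "UCb3 K" and T: "T > 0" and sol: "is_solution K \<xi>0 T \<xi>"
  obtains C \<mu> where "0 < C"
    "\<And>\<eta>0 \<eta> \<epsilon> t. is_solution K \<eta>0 T \<eta> \<Longrightarrow> wdist \<eta>0 \<xi>0 < \<epsilon> \<Longrightarrow> C * \<epsilon> * exp (\<mu> * T) \<le> 1 \<Longrightarrow>
      t \<in> {0..T} \<Longrightarrow> wdist (\<eta> t) (\<xi> t) < C * \<epsilon> * exp (\<mu> * T)"
proof -
  obtain \<kappa> where \<kappa>: "0 \<le> \<kappa>" and sup: "\<And>(\<xi>::'n current) x. norm (conv K \<xi> x) \<le> \<kappa> * wnorm \<xi>"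
    and C11: "\<And>\<xi>::'n current. C11_bound (\<kappa> * wnorm \<xi>) (\<kappa> * wnorm \<xi>) (conv K \<xi>)"
    using UCb3_conv_bounds[OF K] by blast
  obtain \<phi> where \<xi>c: "wcont_on T \<xi>" and \<xi>init: "\<xi> 0 = \<xi>0"
    and \<phi>: "is_flow (\<lambda>t. conv K (\<xi> t)) T \<phi>" and \<xi>push: "\<And>t. t \<in> {0..T} \<Longrightarrow> \<xi> t = push (\<phi> t) \<xi>0"
    using sol unfolding is_solution_def by blast
  obtain M where M: "0 \<le> M" "\<And>t. t \<in> {0..T} \<Longrightarrow> wnorm (\<xi> t) \<le> M"
    using wcont_on_wnorm_bounded[OF \<xi>c] by blast
  define L where "L = \<kappa> * (M + 1)"
  define G where "G = exp (L * T)"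
  define H where "H = exp (2 * L * T)"
  define C0 where "C0 = G + H + G * G"
  define Q where "Q = norm \<xi>0 * G * \<kappa>"
  \<comment> \<open>The assumed bound will return multiplied by \<open>2 * Q / (\<mu> - L)\<close>.
    The term \<open>4 * Q\<close> brings this factor to at most 1/2, and the 1 keeps the denominator
    positive.\<close>
  define \<mu> where "\<mu> = L + 1 + 4 * Q"
  have L: "0 \<le> L" using \<kappa> M by (simp add: L_def)
  have G: "0 < G" "0 < H" by (auto simp: G_def H_def)
  have G1: "1 \<le> G" using L T by (simp add: G_def)
  have C0: "1 \<le> C0" using G G1 by (simp add: C0_def add_increasing2)
  have Q: "0 \<le> Q" using \<kappa> G by (simp add: Q_def)
  have \<mu>: "L < \<mu>" "0 \<le> \<mu>" "1 + 4 * Q = \<mu> - L" using Q L by (auto simp: \<mu>_def)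
  have field: "C11_bound L L (conv K \<zeta>)" if "wnorm \<zeta> \<le> M + 1" for \<zeta> :: "'n current"
    using that \<kappa> unfolding L_def by (intro C11_bound_mono[OF C11] mult_left_mono) auto
  show thesis
  proof (rule that[of "2 * C0" \<mu>])
    show "0 < 2 * C0" using C0 by simp
    fix \<eta>0 :: "'n current" and \<eta> \<epsilon> t
    assume sol': "is_solution K \<eta>0 T \<eta>" and \<epsilon>: "wdist \<eta>0 \<xi>0 < \<epsilon>"
      and small: "2 * C0 * \<epsilon> * exp (\<mu> * T) \<le> 1" and t: "t \<in> {0..T}"
    obtain \<psi> where \<eta>c: "wcont_on T \<eta>" and \<eta>init: "\<eta> 0 = \<eta>0"
      and \<psi>: "is_flow (\<lambda>t. conv K (\<eta> t)) T \<psi>" and \<eta>push: "\<And>t. t \<in> {0..T} \<Longrightarrow> \<eta> t = push (\<psi> t) \<eta>0"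
      using sol' unfolding is_solution_def by blast
    have \<epsilon>0: "0 \<le> wdist \<eta>0 \<xi>0" "0 < \<epsilon>" using wnorm_nonneg[of "\<eta>0 - \<xi>0"] \<epsilon> by (auto simp: wdist_def)
    \<comment> \<open>Twice \<open>C0 * \<epsilon>\<close>: the initial distance uses up half of the
      bound and leaves the other half to the feedback through the flows.\<close>
    define b where "b = 2 * C0 * \<epsilon>"
    have b: "0 < b" using C0 \<epsilon>0 by (simp add: b_def)
    have mono: "b * exp (\<mu> * s) \<le> b * exp (\<mu> * T)" if "s \<le> T" for s
      using that b \<mu> by (auto intro!: mult_left_mono)
    have "wdist (\<eta> t) (\<xi> t) - b * exp (\<mu> * t) < 0"
    proof (rule first_exit[OF _ _ _ t])
      show "continuous_on {0..T} (\<lambda>t. wdist (\<eta> t) (\<xi> t) - b * exp (\<mu> * t))"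
        by (intro continuous_intros continuous_on_wdist \<eta>c \<xi>c)
      have "\<epsilon> \<le> 2 * C0 * \<epsilon>" using C0 \<epsilon>0 by simp
      then show "wdist (\<eta> 0) (\<xi> 0) - b * exp (\<mu> * 0) < 0"
        using less_le_trans[OF \<epsilon>] by (simp add: \<eta>init \<xi>init b_def)
      fix r assume r: "r \<in> {0..T}"
        and le: "\<And>s. s \<in> {0..r} \<Longrightarrow> wdist (\<eta> s) (\<xi> s) - b * exp (\<mu> * s) \<le> 0"
      have sT: "s \<in> {0..T}" if "s \<in> {0..r}" for s using that r by auto
      have d: "wnorm (\<eta> s - \<xi> s) \<le> b * exp (\<mu> * s)" if "s \<in> {0..r}" for s
        using le[OF that] by (simp add: wdist_def)
      have \<xi>f: "C11_bound L L (conv K (\<xi> s))" if "s \<in> {0..r}" for s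
        using M(2)[OF sT[OF that]] by (intro field) simp
      have \<eta>f: "C11_bound L L (conv K (\<eta> s))" if s: "s \<in> {0..r}" for s
      proof (rule field)
        have "wnorm (\<eta> s) \<le> wnorm (\<xi> s) + wnorm (\<eta> s - \<xi> s)"
          using wnorm_triangle[of "\<xi> s" "\<eta> s - \<xi> s"] by simp
        then show "wnorm (\<eta> s) \<le> M + 1"
          using M(2)[OF sT[OF s]] d[OF s] mono[of s] small sT[OF s] by (simp add: b_def)
      qed
      note \<phi>r = is_flow_subinterval[OF \<phi>, of r] and \<psi>r = is_flow_subinterval[OF \<psi>, of r]
      have rT: "r \<le> T" "r \<in> {0..r}" using r by auto
      define D where "D = \<kappa> * b"
      have D0: "0 \<le> D" using \<kappa> b by (simp add: D_def)
      have k: "\<kappa> * wnorm (\<eta> s - \<xi> s) \<le> D * exp (\<mu> * s)" if "s \<in> {0..r}" for s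
        using mult_left_mono[OF d[OF that] \<kappa>] by (simp add: D_def mult.assoc)
      have dsup: "norm (conv K (\<eta> s) x - conv K (\<xi> s) x) \<le> D * exp (\<mu> * s)" if "s \<in> {0..r}" for s x
        using sup[of "\<eta> s - \<xi> s" x] k[OF that] by (simp add: conv_minus_current)
      have dlip: "norm ((conv K (\<eta> s) y - conv K (\<xi> s) y) - (conv K (\<eta> s) x - conv K (\<xi> s) x))
          \<le> D * exp (\<mu> * s) * norm (y - x)" if "s \<in> {0..r}" for s x y
        using C11_boundD(1)[OF C11[of "\<eta> s - \<xi> s"], of y x] mult_right_mono[OF k[OF that] norm_ge_zero[of "y - x"]]
        by (simp add: conv_minus_current)
      note cmp = flow_difference_bounds[OF \<phi>r \<psi>r \<xi>f \<eta>f dsup dlip L \<mu>(1) D0 rT(2)]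
      define E where "E = D / (\<mu> - L) * exp (\<mu> * r)"
      have E0: "0 \<le> E" using D0 \<mu> by (simp add: E_def)
      have expr: "exp (L * r) \<le> G" "exp (2 * L * r) \<le> H"
        using L r unfolding G_def H_def by (auto intro!: mult_left_mono)
      have "exp ((\<mu> + L) * r) = exp (\<mu> * r) * exp (L * r)" by (simp add: exp_add[symmetric] algebra_simps)
      \<comment> \<open>Absorbing \<open>exp (L * r)\<close> into \<open>G\<close> brings the second
        bound to the rate \<mu>, so that it can be compared with
        \<open>b * exp (\<mu> * r)\<close>.\<close>
      then have GE: "D / (\<mu> - L) * exp ((\<mu> + L) * r) \<le> G * E"
        using mult_left_mono[OF expr(1) E0] by (simp add: E_def mult_ac)
      have "wdist (\<eta> r) (\<xi> r) = wdist (push (\<psi> r) \<eta>0) (push (\<phi> r) \<xi>0)"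
        using \<eta>push \<xi>push r by simp
      also have "\<dots> \<le> wdist \<eta>0 \<xi>0 * (G + H + G * G) + norm \<xi>0 * (G * E + G * E)"
      proof (rule wdist_push_le)
        show "C11_bound G H (\<phi> r)"
          using rT by (intro C11_bound_mono[OF flow_C11_bound[OF \<phi>r \<xi>f L]] expr) auto
        show "C11_bound G H (\<psi> r)"
          using rT by (intro C11_bound_mono[OF flow_C11_bound[OF \<psi>r \<eta>f L]] expr) auto
        show "norm (\<psi> r x - \<phi> r x) \<le> E" for x
          using cmp(1)[of x] rT by (simp add: E_def)
        show "norm ((\<psi> r y - \<phi> r y) - (\<psi> r x - \<phi> r x)) \<le> G * E * norm (y - x)" for x y
          using cmp(2)[of y x] rT mult_right_mono[OF GE norm_ge_zero[of "y - x"]] by simp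
        show "0 \<le> G * E" using G E0 by simp
      qed (use G in auto)
      also have "\<dots> = wdist \<eta>0 \<xi>0 * C0 + 2 * Q / (\<mu> - L) * (b * exp (\<mu> * r))"
        by (simp add: C0_def E_def D_def Q_def algebra_simps)
      \<comment> \<open>Strictness comes from \<open>wdist \<eta>0 \<xi>0 < \<epsilon>\<close>. The
        initial distance itself may be zero, whereas the exit argument needs \<open>b\<close>
        positive; hence the separate \<epsilon>.\<close>
      also have "\<dots> < \<epsilon> * C0 + 1 / 2 * (b * exp (\<mu> * r))"
      proof (rule add_less_le_mono)
        show "wdist \<eta>0 \<xi>0 * C0 < \<epsilon> * C0" using \<epsilon> C0 by simp
        have "2 * Q / (\<mu> - L) \<le> 1 / 2" unfolding \<mu>(3)[symmetric] using Q by (simp add: field_simps)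
        then show "2 * Q / (\<mu> - L) * (b * exp (\<mu> * r)) \<le> 1 / 2 * (b * exp (\<mu> * r))"
          using b by (intro mult_right_mono) auto
      qed
      also have "\<epsilon> * C0 \<le> 1 / 2 * (b * exp (\<mu> * r))"
      proof -
        have "b * 1 \<le> b * exp (\<mu> * r)" using b \<mu> r by (intro mult_left_mono) auto
        then show ?thesis by (simp add: b_def mult_ac)
      qed
      finally show "wdist (\<eta> r) (\<xi> r) - b * exp (\<mu> * r) < 0" by simp
    qed
    then show "wdist (\<eta> t) (\<xi> t) < 2 * C0 * \<epsilon> * exp (\<mu> * T)"
      using mono[of t] t by (simp add: b_def)
  qed
qed

section \<open>Currents carried by curves\<close>

text \<open>\<open>C1_differentiable_on\<close> supplies two-sided derivatives at all points of the
  interval; uniqueness of derivatives within the interval identifies them with those in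
  \<open>curve_current\<close>.\<close>

lemma C1_curve_vector_derivative:
  fixes g :: "real \<Rightarrow> real^'n"
  assumes "g C1_differentiable_on {0..1}"
  shows "continuous_on {0..1} g"
    and "continuous_on {0..1} (\<lambda>s. vector_derivative g (at s within {0..1}))"
proof -
  obtain D where D: "\<And>s. s \<in> {0..1} \<Longrightarrow> (g has_vector_derivative D s) (at s)" "continuous_on {0..1} D"
    using assms unfolding C1_differentiable_on_def by blast
  show "continuous_on {0..1} g"
    by (rule continuous_on_vector_derivative) (rule has_vector_derivative_at_within[OF D(1)])
  have "vector_derivative g (at s within {0..1}) = D s" if "s \<in> {0..1}" for s
    using vector_derivative_within_cbox[of 0 1 s g "D s"] that has_vector_derivative_at_within[OF D(1)[OF that]]
    by simp
  then show "continuous_on {0..1} (\<lambda>s. vector_derivative g (at s within {0..1}))"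
    by (intro continuous_on_eq[OF D(2)]) simp
qed

lemma curve_current_apply:
  fixes g :: "real \<Rightarrow> real^'n"
  assumes "g C1_differentiable_on {0..1}"
  shows "blinfun_apply (curve_current g) \<theta> = integral {0..1}
    (\<lambda>s. apply_bcontfun \<theta> (g s) \<bullet> vector_derivative g (at s within {0..1}))"
proof -
  define g' where "g' s = vector_derivative g (at s within {0..1})" for s
  have c: "continuous_on {0..1} g" "continuous_on {0..1} g'"
    using C1_curve_vector_derivative[OF assms] by (auto simp: g'_def)
  have cont: "continuous_on {0..1} (\<lambda>s. apply_bcontfun \<theta> (g s) \<bullet> g' s)" for \<theta> :: "(real^'n) \<Rightarrow>\<^sub>C (real^'n)"
    by (intro continuous_intros c continuous_on_compose2[OF continuous_on_apply_bcontfun c(1)]) auto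
  note int = integrable_continuous_interval[OF cont]
  obtain B where B: "\<And>s. s \<in> {0..1} \<Longrightarrow> norm (g' s) \<le> B"
    using compact_imp_bounded[OF compact_continuous_image[OF c(2) compact_Icc]] 
    unfolding bounded_iff by blast
  have "bounded_linear (\<lambda>\<theta>. integral {0..1} (\<lambda>s. apply_bcontfun \<theta> (g s) \<bullet> g' s))"
  proof (rule bounded_linear_intro)
    fix \<theta> \<eta> :: "(real^'n) \<Rightarrow>\<^sub>C (real^'n)" and r :: real
    show "integral {0..1} (\<lambda>s. apply_bcontfun (\<theta> + \<eta>) (g s) \<bullet> g' s)
        = integral {0..1} (\<lambda>s. apply_bcontfun \<theta> (g s) \<bullet> g' s) + integral {0..1} (\<lambda>s. apply_bcontfun \<eta> (g s) \<bullet> g' s)"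
      by (simp add: inner_add_left integral_add[OF int int])
    show "integral {0..1} (\<lambda>s. apply_bcontfun (r *\<^sub>R \<theta>) (g s) \<bullet> g' s)
        = r *\<^sub>R integral {0..1} (\<lambda>s. apply_bcontfun \<theta> (g s) \<bullet> g' s)"
      by simp
    have "norm (integral {0..1} (\<lambda>s. apply_bcontfun \<theta> (g s) \<bullet> g' s)) \<le> (norm \<theta> * B) * (1 - 0)"
    proof (rule integral_bound[OF _ cont])
      fix s :: real assume "s \<in> {0..1}"
      then show "norm (apply_bcontfun \<theta> (g s) \<bullet> g' s) \<le> norm \<theta> * B"
        using B norm_bounded[of \<theta> "g s"]
        by (intro order_trans[OF Cauchy_Schwarz_ineq2[folded real_norm_def] mult_mono]) auto
    qed simp
    then show "norm (integral {0..1} (\<lambda>s. apply_bcontfun \<theta> (g s) \<bullet> g' s)) \<le> norm \<theta> * B" by simp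
  qed
  then show ?thesis unfolding curve_current_def g'_def by (simp add: bounded_linear_Blinfun_apply)
qed

text \<open>The right-hand side is the velocity in the equation for \<open>\<gamma>\<close>. Thus
  every curve point moves along the field generated by the current of all curves, and the field
  estimates apply to it.\<close>

lemma conv_sum_curve_current:
  fixes K :: "real^'n \<Rightarrow> real^'n^'n" and g :: "nat \<Rightarrow> real \<Rightarrow> real^'n"
  assumes K: "K \<in> bcontfun" and g: "\<And>j. j \<in> J \<Longrightarrow> g j C1_differentiable_on {0..1}"
  shows "conv K (\<Sum>j\<in>J. c j *\<^sub>R curve_current (g j)) x = (\<Sum>j\<in>J. c j *\<^sub>R integral {0..1}
    (\<lambda>s. K (x - g j s) *v vector_derivative (g j) (at s within {0..1})))"
proof -
  have "blinfun_apply (curve_current (g j)) (Bcontfun (\<lambda>z. K (x - z) $ i))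
    = integral {0..1} (\<lambda>s. K (x - g j s) *v vector_derivative (g j) (at s within {0..1})) $ i"
    if j: "j \<in> J" for i j
  proof -
    note c = C1_curve_vector_derivative[OF g[OF j]]
    have Kc: "continuous_on UNIV K" using K by (simp add: bcontfun_def)
    have "continuous_on {0..1} (\<lambda>s. K (x - g j s))"
      by (intro continuous_on_compose2[OF Kc] continuous_intros c) auto
    then have "continuous_on {0..1} (\<lambda>s. \<chi> i. K (x - g j s) $ i \<bullet> vector_derivative (g j) (at s within {0..1}))"
      by (intro continuous_intros c)
    moreover have "(\<lambda>s. K (x - g j s) *v vector_derivative (g j) (at s within {0..1}))
        = (\<lambda>s. \<chi> i. K (x - g j s) $ i \<bullet> vector_derivative (g j) (at s within {0..1}))"
      by (simp add: fun_eq_iff vec_eq_iff matrix_vector_mul_component)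
    ultimately have "continuous_on {0..1} (\<lambda>s. K (x - g j s) *v vector_derivative (g j) (at s within {0..1}))"
      by (simp only:)
    from integral_component_eq_cart[OF integrable_continuous_interval[OF this], of i]
    show ?thesis
      by (simp add: curve_current_apply[OF g[OF j]] Bcontfun_inverse[OF row_bcontfun[OF K]]
          matrix_vector_mul_component)
  qed
  then show ?thesis
    by (simp add: conv_def vec_eq_iff blinfun.sum_left blinfun.scaleR_left)
qed

section \<open>Convergence of the currents and of the curves\<close>

theorem theorem6p3:
  fixes K :: "real^'n \<Rightarrow> real^'n^'n"
    and \<alpha> :: "nat \<Rightarrow> nat \<Rightarrow> real"
    and \<gamma>0 :: "nat \<Rightarrow> nat \<Rightarrow> real \<Rightarrow> real^'n"
    and \<gamma> \<gamma>bar :: "nat \<Rightarrow> nat \<Rightarrow> real \<Rightarrow> real \<Rightarrow> real^'n"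
    and \<xi>0 :: "'n current"
    and \<xi>N :: "nat \<Rightarrow> real \<Rightarrow> 'n current"
    and \<xi> :: "real \<Rightarrow> 'n current"
    and T :: real
  assumes K: "UCb3 K"
    and C1_0: "\<And>N i. i \<in> {1..N} \<Longrightarrow> \<gamma>0 N i C1_differentiable_on {0..1}"
    and conv0: "(\<lambda>N. wdist (\<Sum>j=1..N. \<alpha> N j *\<^sub>R curve_current (\<gamma>0 N j)) \<xi>0) \<longlonglongrightarrow> 0"
    and T: "T > 0"
    and solN: "\<And>N. is_solution K (\<Sum>j=1..N. \<alpha> N j *\<^sub>R curve_current (\<gamma>0 N j)) T (\<xi>N N)"
    and uniqN: "\<And>N \<eta>. is_solution K (\<Sum>j=1..N. \<alpha> N j *\<^sub>R curve_current (\<gamma>0 N j)) T \<eta>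
                   \<Longrightarrow> \<forall>t\<in>{0..T}. \<eta> t = \<xi>N N t"
    and sol: "is_solution K \<xi>0 T \<xi>"
    and uniq: "\<And>\<eta>. is_solution K \<xi>0 T \<eta> \<Longrightarrow> \<forall>t\<in>{0..T}. \<eta> t = \<xi> t"
    and \<gamma>_C1: "\<And>N i t. i \<in> {1..N} \<Longrightarrow> t \<in> {0..T} \<Longrightarrow> \<gamma> N i t C1_differentiable_on {0..1}"
    and \<gamma>_init: "\<And>N i \<sigma>. i \<in> {1..N} \<Longrightarrow> \<sigma> \<in> {0..1} \<Longrightarrow> \<gamma> N i 0 \<sigma> = \<gamma>0 N i \<sigma>"
    and \<gamma>_ode: "\<And>N i t \<sigma>. i \<in> {1..N} \<Longrightarrow> t \<in> {0..T} \<Longrightarrow> \<sigma> \<in> {0..1} \<Longrightarrow>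
        ((\<lambda>s. \<gamma> N i s \<sigma>) has_vector_derivative
           (\<Sum>j=1..N. \<alpha> N j *\<^sub>R integral {0..1} (\<lambda>\<sigma>'.
               K (\<gamma> N i t \<sigma> - \<gamma> N j t \<sigma>') *v vector_derivative (\<gamma> N j t) (at \<sigma>' within {0..1}))))
        (at t within {0..T})"
    and \<xi>N_repr: "\<And>N t. t \<in> {0..T} \<Longrightarrow> \<xi>N N t = (\<Sum>j=1..N. \<alpha> N j *\<^sub>R curve_current (\<gamma> N j t))"
    and \<gamma>bar_init: "\<And>N i \<sigma>. i \<in> {1..N} \<Longrightarrow> \<sigma> \<in> {0..1} \<Longrightarrow> \<gamma>bar N i 0 \<sigma> = \<gamma>0 N i \<sigma>"
    and \<gamma>bar_ode: "\<And>N i t \<sigma>. i \<in> {1..N} \<Longrightarrow> t \<in> {0..T} \<Longrightarrow> \<sigma> \<in> {0..1} \<Longrightarrow>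
        ((\<lambda>s. \<gamma>bar N i s \<sigma>) has_vector_derivative conv K (\<xi> t) (\<gamma>bar N i t \<sigma>)) (at t within {0..T})"
  shows "(\<forall>e>0. \<forall>\<^sub>F N in sequentially. \<forall>t\<in>{0..T}. wdist (\<xi>N N t) (\<xi> t) < e)
    \<and> (\<forall>i\<ge>1. \<forall>e>0. \<forall>\<^sub>F N in sequentially. \<forall>t\<in>{0..T}. \<forall>\<sigma>\<in>{0..1}.
          norm (\<gamma> N i t \<sigma> - \<gamma>bar N i t \<sigma>) < e)"
proof -
  obtain C \<mu> where C: "0 < C" and stab: "\<And>\<eta>0 \<eta> \<epsilon> t. is_solution K \<eta>0 T \<eta> \<Longrightarrow> wdist \<eta>0 \<xi>0 < \<epsilon> \<Longrightarrow>
      C * \<epsilon> * exp (\<mu> * T) \<le> 1 \<Longrightarrow> t \<in> {0..T} \<Longrightarrow> wdist (\<eta> t) (\<xi> t) < C * \<epsilon> * exp (\<mu> * T)"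
    using solution_stability[OF K T sol] by blast
  have currents: "\<forall>\<^sub>F N in sequentially. \<forall>t\<in>{0..T}. wdist (\<xi>N N t) (\<xi> t) < e" if e: "e > 0" for e
  proof -
    \<comment> \<open>Chosen so that the stability bound equals \<open>min 1 e\<close>; the 1 meets
      the smallness condition of \<open>stab\<close>.\<close>
    define \<epsilon> where "\<epsilon> = min 1 e / (C * exp (\<mu> * T))"
    have "0 < \<epsilon>" using C e by (simp add: \<epsilon>_def)
    have eq: "C * \<epsilon> * exp (\<mu> * T) = min 1 e" using C by (simp add: \<epsilon>_def)
    from order_tendstoD(2)[OF conv0 \<open>0 < \<epsilon>\<close>] show ?thesis
    proof (rule eventually_mono, intro ballI)
      fix N t
      assume "wdist (\<Sum>j=1..N. \<alpha> N j *\<^sub>R curve_current (\<gamma>0 N j)) \<xi>0 < \<epsilon>" and "t \<in> {0..T}"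
      from stab[OF solN this(1) _ this(2)] show "wdist (\<xi>N N t) (\<xi> t) < e" by (simp add: eq)
    qed
  qed
  obtain \<kappa> where \<kappa>: "0 \<le> \<kappa>" and sup: "\<And>(\<xi>::'n current) x. norm (conv K \<xi> x) \<le> \<kappa> * wnorm \<xi>"
    and C11: "\<And>\<xi>::'n current. C11_bound (\<kappa> * wnorm \<xi>) (\<kappa> * wnorm \<xi>) (conv K \<xi>)"
    using UCb3_conv_bounds[OF K] by blast
  obtain M where M: "0 \<le> M" "\<And>t. t \<in> {0..T} \<Longrightarrow> wnorm (\<xi> t) \<le> M"
    using wcont_on_wnorm_bounded sol unfolding is_solution_def by blast
  define L where "L = \<kappa> * M"
  have L: "0 \<le> L" using \<kappa> M by (simp add: L_def)
  have field: "norm (conv K (\<xi> t) y - conv K (\<xi> t) x) \<le> L * norm (y - x)" if "t \<in> {0..T}" for t x y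
    using C11_boundD(1)[OF C11] mult_right_mono[OF mult_left_mono[OF M(2)[OF that] \<kappa>] norm_ge_zero[of "y - x"]]
    unfolding L_def by (rule order_trans)
  have curves: "\<forall>\<^sub>F N in sequentially. \<forall>t\<in>{0..T}. \<forall>\<sigma>\<in>{0..1}. norm (\<gamma> N i t \<sigma> - \<gamma>bar N i t \<sigma>) < e"
    if i: "i \<ge> 1" and e: "e > 0" for i e
  proof -
    \<comment> \<open>The factor \<open>\<kappa> + 1\<close> instead of \<kappa> covers the case
      \<open>\<kappa> = 0\<close> and makes the final inequality strict.\<close>
    define \<epsilon> where "\<epsilon> = e / ((\<kappa> + 1) * exp ((L + 1) * T))"
    have \<epsilon>: "0 < \<epsilon>" using e \<kappa> by (simp add: \<epsilon>_def)
    have small: "\<kappa> * \<epsilon> * exp ((L + 1) * T) < e"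
    proof -
      have "\<kappa> * \<epsilon> * exp ((L + 1) * T) = \<kappa> * e / (\<kappa> + 1)" by (simp add: \<epsilon>_def)
      also have "\<dots> < e" using \<kappa> e by (simp add: pos_divide_less_eq algebra_simps)
      finally show ?thesis .
    qed
    \<comment> \<open>The curve with index \<open>i\<close> belongs to the family only when
      \<open>N \<ge> i\<close>.\<close>
    from currents[OF \<epsilon>] eventually_ge_at_top[of i] show ?thesis
    proof eventually_elim
      case (elim N)
      then have iN: "i \<in> {1..N}" using i by simp
      show ?case
      proof (intro ballI)
        fix t \<sigma> :: real assume t: "t \<in> {0..T}" and \<sigma>: "\<sigma> \<in> {0..1}"
        have "norm (\<gamma> N i t \<sigma> - \<gamma>bar N i t \<sigma>) \<le> \<kappa> * \<epsilon> * exp ((L + 1) * t)"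
        \<comment> \<open>The source is the supremum of the field of
          \<open>\<xi>N N r - \<xi> r\<close>, at most \<open>\<kappa> * \<epsilon>\<close>
          uniformly in \<sigma>. With \<open>c\<close> equal to \<open>A\<close>, the rate
          \<open>L + 1\<close> meets the comparison condition with equality.\<close>
        proof (rule exp_comparison[where A = "\<kappa> * \<epsilon>" and L = L, OF _ _ _ _ _ _ t])
          fix r assume r: "r \<in> {0..T}"
          have "conv K (\<xi>N N r) x = (\<Sum>j=1..N. \<alpha> N j *\<^sub>R integral {0..1} (\<lambda>\<sigma>'.
               K (x - \<gamma> N j r \<sigma>') *v vector_derivative (\<gamma> N j r) (at \<sigma>' within {0..1})))" for x
            unfolding \<xi>N_repr[OF r] using r
            by (intro conv_sum_curve_current[OF UCb3_bcontfun[OF K]] \<gamma>_C1)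
          then have "((\<lambda>s. \<gamma> N i s \<sigma>) has_vector_derivative conv K (\<xi>N N r) (\<gamma> N i r \<sigma>)) (at r within {0..T})"
            using \<gamma>_ode[OF iN r \<sigma>] by simp
          then show "((\<lambda>s. \<gamma> N i s \<sigma> - \<gamma>bar N i s \<sigma>) has_vector_derivative
              conv K (\<xi>N N r) (\<gamma> N i r \<sigma>) - conv K (\<xi> r) (\<gamma>bar N i r \<sigma>)) (at r within {0..T})"
            by (rule has_vector_derivative_diff[OF _ \<gamma>bar_ode[OF iN r \<sigma>]])
          have "norm (conv K (\<xi>N N r - \<xi> r) (\<gamma> N i r \<sigma>)) \<le> \<kappa> * wnorm (\<xi>N N r - \<xi> r)" by (rule sup)
          also have "\<dots> \<le> \<kappa> * \<epsilon>"
            using elim(1) r \<kappa> unfolding wdist_def by (intro mult_left_mono) (auto intro: less_imp_le)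
          also have "\<dots> \<le> \<kappa> * \<epsilon> * exp ((L + 1) * r)"
            using mult_left_mono[of 1 "exp ((L + 1) * r)" "\<kappa> * \<epsilon>"] \<kappa> \<epsilon> L r by simp
          finally have "norm (conv K (\<xi>N N r) (\<gamma> N i r \<sigma>) - conv K (\<xi> r) (\<gamma> N i r \<sigma>))
              \<le> \<kappa> * \<epsilon> * exp ((L + 1) * r)" by (simp add: conv_minus_current)
          \<comment> \<open>Only the limit field is compared at two different points, so the
            Lipschitz constant \<open>L\<close> does not depend on \<open>N\<close>.\<close>
          moreover have "conv K (\<xi>N N r) (\<gamma> N i r \<sigma>) - conv K (\<xi> r) (\<gamma>bar N i r \<sigma>)
              = (conv K (\<xi>N N r) (\<gamma> N i r \<sigma>) - conv K (\<xi> r) (\<gamma> N i r \<sigma>))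
                + (conv K (\<xi> r) (\<gamma> N i r \<sigma>) - conv K (\<xi> r) (\<gamma>bar N i r \<sigma>))" by simp
          ultimately show "norm (conv K (\<xi>N N r) (\<gamma> N i r \<sigma>) - conv K (\<xi> r) (\<gamma>bar N i r \<sigma>))
              \<le> \<kappa> * \<epsilon> * exp ((L + 1) * r) + L * norm (\<gamma> N i r \<sigma> - \<gamma>bar N i r \<sigma>)"
            using norm_triangle_mono[OF _ field[OF r]] by (simp only:)
        next
          show "norm (\<gamma> N i 0 \<sigma> - \<gamma>bar N i 0 \<sigma>) \<le> \<kappa> * \<epsilon>"
            using \<gamma>_init[OF iN \<sigma>] \<gamma>bar_init[OF iN \<sigma>] \<kappa> \<epsilon> by simp
        qed (use L in \<open>auto simp: algebra_simps\<close>)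
        also have "\<dots> \<le> \<kappa> * \<epsilon> * exp ((L + 1) * T)"
          using t L \<kappa> \<epsilon> by (auto intro!: mult_left_mono)
        finally show "norm (\<gamma> N i t \<sigma> - \<gamma>bar N i t \<sigma>) < e" using small by simp
      qed
    qed
  qed
  from currents curves show ?thesis by blast
qed

end
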